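(* Let $(G,\tau,\partial)$ be a Polish topometric group with ample generics. Then $G$ is Steinhaus with exponent $10$: whenever $A\subseteq G$ is symmetric and $\sigma$-syndetic, $1_G\in\mathrm{Int}_\tau\big((A^{10})_\varepsilon\big)$ for every $\varepsilon>0$.
   Context: A Polish topometric group is a triple $(G,\tau,\partial)$ with $(G,\tau)$ a Polish group, $\partial$ a bi-invariant metric (not necessarily separable) whose topology refines $\tau$ and which is $\tau$-lower semi-continuous ($\{(x,y)\colon\partial(x,y)\le r\}$ is $\tau$-closed for all $r$). For $A\subseteq G$, $(A)_\varepsilon=\{g\colon\partial(g,A)<\varepsilon\}$. $G^n$ has the product topology and supremum metric, and $G$ acts on $G^n$ by diagonal conjugation. $(G,\tau,\partial)$ has ample generics if for all $n\in\mathbb N$ and $\varepsilon>0$ there is $\bar g\in G^n$ with $(\{(kg_0k^{-1},\dots,kg_{n-1}k^{-1})\colon k\in G\})_\varepsilon$ co-meagre in $G^n$. A subset $A$ of a group $G$ is $\sigma$-syndetic if $G$ is covered by countably many left translates of $A$. Interiors are taken with respect to $\tau$. *)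

theory Defs
  imports "HOL-Analysis.Analysis" "HOL-Algebra.Algebra"
begin

definition Polish_space :: "'a topology \<Rightarrow> bool" where
  "Polish_space T \<longleftrightarrow> completely_metrizable_space T \<and> separable_space T"

definition Polish_group :: "('a, 'b) monoid_scheme \<Rightarrow> 'a topology \<Rightarrow> bool" where
  "Polish_group G \<tau> \<longleftrightarrow> group G \<and> topspace \<tau> = carrier G \<and> Polish_space \<tau> \<and>
     continuous_map (prod_topology \<tau> \<tau>) \<tau> (\<lambda>(x, y). x \<otimes>\<^bsub>G\<^esub> y) \<and>
     continuous_map \<tau> \<tau> (\<lambda>x. inv\<^bsub>G\<^esub> x)"

definition Polish_topometric_group ::
    "('a, 'b) monoid_scheme \<Rightarrow> 'a topology \<Rightarrow> ('a \<Rightarrow> 'a \<Rightarrow> real) \<Rightarrow> bool" where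
  "Polish_topometric_group G \<tau> d \<longleftrightarrow>
     Polish_group G \<tau> \<and>
     Metric_space (carrier G) d \<and>
     (\<forall>g\<in>carrier G. \<forall>x\<in>carrier G. \<forall>y\<in>carrier G.
         d (g \<otimes>\<^bsub>G\<^esub> x) (g \<otimes>\<^bsub>G\<^esub> y) = d x y \<and>
         d (x \<otimes>\<^bsub>G\<^esub> g) (y \<otimes>\<^bsub>G\<^esub> g) = d x y) \<and>
     (\<forall>U. openin \<tau> U \<longrightarrow> openin (Metric_space.mtopology (carrier G) d) U) \<and>
     (\<forall>r::real. closedin (prod_topology \<tau> \<tau>) {(x, y). x \<in> carrier G \<and> y \<in> carrier G \<and> d x y \<le> r})"

definition nowhere_dense_in :: "'a topology \<Rightarrow> 'a set \<Rightarrow> bool" where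
  "nowhere_dense_in T S \<longleftrightarrow> S \<subseteq> topspace T \<and> T interior_of (T closure_of S) = {}"

definition meagre_in :: "'a topology \<Rightarrow> 'a set \<Rightarrow> bool" where
  "meagre_in T S \<longleftrightarrow> (\<exists>\<F>. countable \<F> \<and> (\<forall>N\<in>\<F>. nowhere_dense_in T N) \<and> S \<subseteq> \<Union>\<F>)"

definition comeagre_in :: "'a topology \<Rightarrow> 'a set \<Rightarrow> bool" where
  "comeagre_in T S \<longleftrightarrow> S \<subseteq> topspace T \<and> meagre_in T (topspace T - S)"

definition power_top :: "'a topology \<Rightarrow> nat \<Rightarrow> (nat \<Rightarrow> 'a) topology" where
  "power_top \<tau> n = product_topology (\<lambda>i. \<tau>) {..<n}"

definition conj_orbit :: "('a, 'b) monoid_scheme \<Rightarrow> nat \<Rightarrow> (nat \<Rightarrow> 'a) \<Rightarrow> (nat \<Rightarrow> 'a) set" where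
  "conj_orbit G n g = {(\<lambda>i. if i < n then k \<otimes>\<^bsub>G\<^esub> g i \<otimes>\<^bsub>G\<^esub> inv\<^bsub>G\<^esub> k else undefined) | k. k \<in> carrier G}"

definition tuple_nbhd :: "('a, 'b) monoid_scheme \<Rightarrow> ('a \<Rightarrow> 'a \<Rightarrow> real) \<Rightarrow> nat \<Rightarrow> (nat \<Rightarrow> 'a) set \<Rightarrow> real \<Rightarrow> (nat \<Rightarrow> 'a) set" where
  "tuple_nbhd G d n B \<epsilon> = {x \<in> extensional_funcset {..<n} (carrier G).
      \<exists>y\<in>B. (MAX i\<in>insert 0 {..<n}. if i < n then d (x i) (y i) else 0) < \<epsilon>}"

definition ample_generics :: "('a, 'b) monoid_scheme \<Rightarrow> 'a topology \<Rightarrow> ('a \<Rightarrow> 'a \<Rightarrow> real) \<Rightarrow> bool" where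
  "ample_generics G \<tau> d \<longleftrightarrow> (\<forall>n::nat. \<forall>\<epsilon>>0. \<exists>g\<in>extensional_funcset {..<n} (carrier G).
      comeagre_in (power_top \<tau> n) (tuple_nbhd G d n (conj_orbit G n g) \<epsilon>))"

definition set_nbhd :: "('a, 'b) monoid_scheme \<Rightarrow> ('a \<Rightarrow> 'a \<Rightarrow> real) \<Rightarrow> 'a set \<Rightarrow> real \<Rightarrow> 'a set" where
  "set_nbhd G d A \<epsilon> = {g \<in> carrier G. \<exists>a\<in>A. d g a < \<epsilon>}"

fun set_pow :: "('a, 'b) monoid_scheme \<Rightarrow> 'a set \<Rightarrow> nat \<Rightarrow> 'a set" where
  "set_pow G A 0 = {\<one>\<^bsub>G\<^esub>}"
| "set_pow G A (Suc n) = A <#>\<^bsub>G\<^esub> set_pow G A n"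

definition symmetric_set :: "('a, 'b) monoid_scheme \<Rightarrow> 'a set \<Rightarrow> bool" where
  "symmetric_set G A \<longleftrightarrow> A \<subseteq> carrier G \<and> (\<lambda>a. inv\<^bsub>G\<^esub> a) ` A = A"

definition sigma_syndetic :: "('a, 'b) monoid_scheme \<Rightarrow> 'a set \<Rightarrow> bool" where
  "sigma_syndetic G A \<longleftrightarrow> A \<subseteq> carrier G \<and>
     (\<exists>C. countable C \<and> C \<subseteq> carrier G \<and> carrier G \<subseteq> (\<Union>c\<in>C. c <#\<^bsub>G\<^esub> A))"

end

theory Submission
  imports Defs
begin

text \<open>
  Since \<open>A\<close> is not meagre, it is non-meagre in every open part of some open set \<open>U \<noteq> {}\<close>. If \<open>g\<close> is
  so close to \<open>1\<close> that \<open>gU\<close> meets \<open>U\<close>, then \<open>gA\<close> and \<open>A\<close> are both everywhere non-meagre in \<open>U \<inter> gU\<close>.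
  Along the nodes of the binary tree one chooses tuples, prolonged at each node by some \<open>y \<in> gA\<close> to the
  left and some \<open>z \<in> A\<close> to the right, such that an element \<open>f\<close> near \<open>1\<close> conjugates \<open>z\<close> almost to \<open>y\<close> while
  almost fixing the tuple built so far; ample generics provide \<open>f\<close>. The products of the elements \<open>f\<close>
  converge along each branch \<open>a\<close> to some \<open>h\<^sub>a\<close>, and if \<open>a\<close> and \<open>b\<close> split at a node with entries
  \<open>y\<close> and \<open>z\<close>, then \<open>h\<^sub>a y h\<^sub>a\<inverse>\<close> and \<open>h\<^sub>b z h\<^sub>b\<inverse>\<close> are \<open>\<epsilon>\<close>-close. There
  are uncountably many branches, so two of them have \<open>h\<^sub>a\<close> and \<open>h\<^sub>b\<close> in the same translate of \<open>A\<close>, which puts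
  \<open>g\<close> within \<open>\<epsilon>\<close> of \<open>A\<^sup>6\<close>, hence of the larger set \<open>A\<close> to the power \<open>10\<close>.
\<close>

subsection \<open>Meagre sets\<close>

lemma meagre_in_subset: "meagre_in T S \<Longrightarrow> R \<subseteq> S \<Longrightarrow> meagre_in T R"
  unfolding meagre_in_def by (meson order_trans)

lemma meagre_in_empty [simp]: "meagre_in T {}"
  unfolding meagre_in_def by (intro exI[of _ "{}"]) auto

lemma nowhere_dense_in_imp_meagre_in: "nowhere_dense_in T S \<Longrightarrow> meagre_in T S"
  unfolding meagre_in_def by (intro exI[of _ "{S}"]) auto

lemma meagre_in_UN:
  assumes "countable I" and "\<And>i. i \<in> I \<Longrightarrow> meagre_in T (S i)"
  shows "meagre_in T (\<Union>i\<in>I. S i)"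
proof -
  have "\<forall>i\<in>I. \<exists>\<F>. countable \<F> \<and> (\<forall>N\<in>\<F>. nowhere_dense_in T N) \<and> S i \<subseteq> \<Union>\<F>"
    using assms(2) unfolding meagre_in_def by blast
  then obtain \<F> where F: "\<forall>i\<in>I. countable (\<F> i) \<and> (\<forall>N\<in>\<F> i. nowhere_dense_in T N) \<and> S i \<subseteq> \<Union>(\<F> i)"
    by metis
  show ?thesis
    unfolding meagre_in_def
  proof (intro exI[of _ "\<Union>i\<in>I. \<F> i"] conjI)
    show "countable (\<Union>i\<in>I. \<F> i)" using F assms(1) by simp
    show "\<forall>N\<in>\<Union>i\<in>I. \<F> i. nowhere_dense_in T N" using F by simp
    show "(\<Union>i\<in>I. S i) \<subseteq> \<Union>(\<Union>i\<in>I. \<F> i)"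
    proof (rule UN_least)
      fix i assume i: "i \<in> I"
      then have "S i \<subseteq> \<Union>(\<F> i)" using F by simp
      also have "\<dots> \<subseteq> \<Union>(\<Union>i\<in>I. \<F> i)" using i by (intro Union_mono) auto
      finally show "S i \<subseteq> \<Union>(\<Union>i\<in>I. \<F> i)" .
    qed
  qed
qed

lemma meagre_in_Un: "meagre_in T R \<Longrightarrow> meagre_in T S \<Longrightarrow> meagre_in T (R \<union> S)"
  using meagre_in_UN[of "{R, S}" T id] by auto

lemma nowhere_dense_in_closedin:
  "closedin T C \<Longrightarrow> T interior_of C = {} \<Longrightarrow> nowhere_dense_in T C"
  by (simp add: nowhere_dense_in_def closure_of_closedin closedin_subset)

text \<open>The Baire category theorem in the form needed: the closures of the nowhere dense sets
  covering \<open>U\<close> have a union with empty interior.\<close>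

lemma meagre_in_openin_empty:
  assumes "completely_metrizable_space T" "openin T U" "meagre_in T U"
  shows "U = {}"
proof -
  obtain \<F> where F: "countable \<F>" "\<And>N. N \<in> \<F> \<Longrightarrow> nowhere_dense_in T N" "U \<subseteq> \<Union>\<F>"
    using assms(3) unfolding meagre_in_def by blast
  have "T interior_of \<Union>((closure_of) T ` \<F>) = {}"
    by (rule Baire_category_alt) (use assms(1) F(1,2) in \<open>auto simp: nowhere_dense_in_def\<close>)
  moreover have "N \<subseteq> T closure_of N" if "N \<in> \<F>" for N
    using F(2)[OF that] by (simp add: nowhere_dense_in_def closure_of_subset)
  then have "U \<subseteq> \<Union>((closure_of) T ` \<F>)"
    using F(3) by blast
  ultimately show ?thesis
    using interior_of_maximal[OF _ assms(2)] by blast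
qed

lemma meagre_in_homeomorphic_image:
  assumes f: "homeomorphic_map S T f" and S: "meagre_in S A"
  shows "meagre_in T (f ` A)"
proof -
  obtain \<F> where F: "countable \<F>" "\<And>N. N \<in> \<F> \<Longrightarrow> nowhere_dense_in S N" "A \<subseteq> \<Union>\<F>"
    using S unfolding meagre_in_def by blast
  have "nowhere_dense_in T (f ` N)" if "N \<in> \<F>" for N
  proof -
    have N: "N \<subseteq> topspace S" "S interior_of (S closure_of N) = {}"
      using F(2)[OF that] by (auto simp: nowhere_dense_in_def)
    have "T interior_of (T closure_of (f ` N)) = f ` (S interior_of (S closure_of N))"
      using homeomorphic_map_closure_of[OF f N(1)]
        homeomorphic_map_interior_of[OF f closure_of_subset_topspace] by simp
    moreover have "f ` N \<subseteq> topspace T"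
      using N(1) homeomorphic_imp_surjective_map[OF f] by blast
    ultimately show ?thesis
      using N(2) by (simp add: nowhere_dense_in_def)
  qed
  then show ?thesis
    unfolding meagre_in_def
  proof (intro exI[of _ "(`) f ` \<F>"] conjI)
    show "f ` A \<subseteq> \<Union>((`) f ` \<F>)" using image_mono[OF F(3)] by (simp add: image_Union)
  qed (use F(1) in auto)
qed

text \<open>One half of the Kuratowski-Ulam theorem. A section of a closed set that is not nowhere
  dense contains a nonempty basic open set \<open>V\<close>; for each of the countably many
  \<open>V\<close> the base points where this happens form a nowhere dense set
  \<open>E N V\<close>.\<close>

lemma meagre_in_prod_topology_sections:
  assumes "second_countable Y" and S: "meagre_in (prod_topology Z Y) S"
  shows "meagre_in Z {x \<in> topspace Z. \<not> meagre_in Y {y. (x, y) \<in> S}}"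
proof -
  obtain \<B> where B: "countable \<B>" "\<And>V. V \<in> \<B> \<Longrightarrow> openin Y V"
    "\<And>U x. openin Y U \<Longrightarrow> x \<in> U \<Longrightarrow> \<exists>V\<in>\<B>. x \<in> V \<and> V \<subseteq> U"
    using assms(1) unfolding second_countable_def by metis
  obtain \<F> where F: "countable \<F>" "\<And>N. N \<in> \<F> \<Longrightarrow> nowhere_dense_in (prod_topology Z Y) N" "S \<subseteq> \<Union>\<F>"
    using S unfolding meagre_in_def by blast
  define C where "C N = (prod_topology Z Y) closure_of N" for N
  define E where "E N V = {x \<in> topspace Z. {x} \<times> V \<subseteq> C N}" for N V
  have E: "meagre_in Z (E N V)" if N: "N \<in> \<F>" and V: "V \<in> \<B>" "V \<noteq> {}" for N V
  proof (rule nowhere_dense_in_imp_meagre_in[OF nowhere_dense_in_closedin])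
    have clo: "closedin (prod_topology Z Y) (C N)" 
      by (simp add: C_def)
    have "closedin Z {x \<in> topspace Z. (x, y) \<in> C N}" if "y \<in> V" for y
    proof -
      have "y \<in> topspace Y" using that B(2)[OF V(1)] openin_subset by blast
      then have "continuous_map Z (prod_topology Z Y) (\<lambda>x. (x, y))"
        by (simp add: continuous_map_pairedI)
      from closedin_continuous_map_preimage[OF this clo] show ?thesis .
    qed
    moreover have "E N V = (\<Inter>y\<in>V. {x \<in> topspace Z. (x, y) \<in> C N})"
      using V(2) by (auto simp: E_def)
    ultimately show "closedin Z (E N V)"
      using V(2) by auto
    \<comment> \<open>Were \<open>?I\<close> nonempty, the open box \<open>?I \<times> V\<close>
      would lie in the closure of the nowhere dense set \<open>N\<close>.\<close>
    let ?I = "Z interior_of (E N V)"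
    have "openin (prod_topology Z Y) (?I \<times> V)"
      using B(2)[OF V(1)] by (simp add: openin_prod_Times_iff)
    moreover have "?I \<times> V \<subseteq> C N"
      using interior_of_subset[of Z "E N V"] by (auto simp: E_def)
    ultimately have "?I \<times> V \<subseteq> (prod_topology Z Y) interior_of (C N)"
      by (rule interior_of_maximal[rotated])
    also have "\<dots> = {}"
      using F(2)[OF N] by (simp add: nowhere_dense_in_def C_def)
    finally show "?I = {}" using V(2) by blast
  qed
  have "{x \<in> topspace Z. \<not> meagre_in Y {y. (x, y) \<in> S}} \<subseteq> (\<Union>N\<in>\<F>. \<Union>V\<in>\<B>-{{}}. E N V)"
  proof (rule subsetI, rule ccontr)
    fix x assume x: "x \<in> {x \<in> topspace Z. \<not> meagre_in Y {y. (x, y) \<in> S}}"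
      and no: "x \<notin> (\<Union>N\<in>\<F>. \<Union>V\<in>\<B>-{{}}. E N V)"
    have "nowhere_dense_in Y {y \<in> topspace Y. (x, y) \<in> C N}" if N: "N \<in> \<F>" for N
    proof (rule nowhere_dense_in_closedin)
      have "continuous_map Y (prod_topology Z Y) (\<lambda>y. (x, y))"
        using x by (simp add: continuous_map_pairedI)
      then show "closedin Y {y \<in> topspace Y. (x, y) \<in> C N}"
        by (rule closedin_continuous_map_preimage) (simp add: C_def)
      show "Y interior_of {y \<in> topspace Y. (x, y) \<in> C N} = {}" (is "?I = {}")
      proof (rule ccontr)
        assume "?I \<noteq> {}"
        then obtain y where "y \<in> ?I" by blast
        then obtain V where V: "V \<in> \<B>" "y \<in> V" "V \<subseteq> ?I"
          using B(3)[OF openin_interior_of] by blast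
        then have "x \<in> E N V"
          using x interior_of_subset[of Y "{y \<in> topspace Y. (x, y) \<in> C N}"] by (auto simp: E_def)
        then show False using no N V by blast
      qed
    qed
    then have "meagre_in Y (\<Union>N\<in>\<F>. {y \<in> topspace Y. (x, y) \<in> C N})"
      by (intro meagre_in_UN F(1) nowhere_dense_in_imp_meagre_in)
    moreover have "{y. (x, y) \<in> S} \<subseteq> (\<Union>N\<in>\<F>. {y \<in> topspace Y. (x, y) \<in> C N})"
    proof 
      fix y assume "y \<in> {y. (x, y) \<in> S}"
      then obtain N where N: "N \<in> \<F>" "(x, y) \<in> N" using F(3) by blast
      have "N \<subseteq> topspace (prod_topology Z Y)" using F(2)[OF N(1)] by (simp add: nowhere_dense_in_def)
      then have "(x, y) \<in> C N" "y \<in> topspace Y"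
        using N closure_of_subset[of N "prod_topology Z Y"] by (auto simp: C_def)
      then show "y \<in> (\<Union>N\<in>\<F>. {y \<in> topspace Y. (x, y) \<in> C N})" using N by blast
    qed
    ultimately show False
      using x meagre_in_subset by blast
  qed
  moreover have "meagre_in Z (\<Union>N\<in>\<F>. \<Union>V\<in>\<B>-{{}}. E N V)"
    by (intro meagre_in_UN E F(1) countable_Diff B(1)) auto
  ultimately show ?thesis
    by (rule meagre_in_subset[rotated])
qed

section \<open>Non-meagreness at points, and projections of closed sets\<close>

text \<open>An open set is contained in it exactly when \<open>S\<close> is non-meagre in every
  nonempty open subset of that set; this is how it is used below.\<close>

definition nonmeagre_points :: "'a topology \<Rightarrow> 'a set \<Rightarrow> 'a set" where
  "nonmeagre_points T S = {x \<in> topspace T. \<forall>U. openin T U \<and> x \<in> U \<longrightarrow> \<not> meagre_in T (S \<inter> U)}"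

lemma topspace_Diff_nonmeagre_points:
  "topspace T - nonmeagre_points T S = \<Union>{U. openin T U \<and> meagre_in T (S \<inter> U)}"
  using openin_subset by (fastforce simp: nonmeagre_points_def)

lemma closedin_nonmeagre_points: "closedin T (nonmeagre_points T S)"
  unfolding closedin_def topspace_Diff_nonmeagre_points
  by (auto simp: nonmeagre_points_def)

text \<open>A case of the Banach category theorem. By second countability the points removed are
  covered by countably many basic sets \<open>V\<close> with \<open>S \<inter> V\<close>
  meagre.\<close>

lemma meagre_in_Diff_nonmeagre_points:
  assumes "second_countable T" "S \<subseteq> topspace T"
  shows "meagre_in T (S - nonmeagre_points T S)"
proof -
  obtain \<B> where B: "countable \<B>" "\<And>V. V \<in> \<B> \<Longrightarrow> openin T V"
    "\<And>U x. openin T U \<Longrightarrow> x \<in> U \<Longrightarrow> \<exists>V\<in>\<B>. x \<in> V \<and> V \<subseteq> U"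
    using assms(1) unfolding second_countable_def by metis
  have "S - nonmeagre_points T S \<subseteq> (\<Union>V\<in>{V\<in>\<B>. meagre_in T (S \<inter> V)}. S \<inter> V)"
  proof
    fix x assume x: "x \<in> S - nonmeagre_points T S"
    then obtain U where U: "openin T U" "x \<in> U" "meagre_in T (S \<inter> U)"
      using assms(2) by (auto simp: nonmeagre_points_def)
    then obtain V where "V \<in> \<B>" "x \<in> V" "V \<subseteq> U" using B(3) by blast
    moreover from this have "meagre_in T (S \<inter> V)"
      using U(3) meagre_in_subset[of T "S \<inter> U" "S \<inter> V"] by blast
    ultimately show "x \<in> (\<Union>V\<in>{V\<in>\<B>. meagre_in T (S \<inter> V)}. S \<inter> V)" using x by blast
  qed
  moreover have "meagre_in T (\<Union>V\<in>{V\<in>\<B>. meagre_in T (S \<inter> V)}. S \<inter> V)"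
    by (rule meagre_in_UN) (use B(1) in auto)
  ultimately show ?thesis by (rule meagre_in_subset[rotated])
qed

lemma meagre_in_Diff_interior_of:
  assumes "closedin T C"
  shows "meagre_in T (C - T interior_of C)"
proof (rule nowhere_dense_in_imp_meagre_in[OF nowhere_dense_in_closedin])
  show "closedin T (C - T interior_of C)"
    using assms by (simp add: closedin_diff)
  show "T interior_of (C - T interior_of C) = {}"
    using interior_of_mono[of "C - T interior_of C" C T] interior_of_subset[of T "C - T interior_of C"]
    by blast
qed

text \<open>The interior of \<open>nonmeagre_points T S\<close> is a witness. If it were empty, that
  closed set would be nowhere dense, and \<open>S\<close> would exceed it only by a meagre
  set.\<close>

lemma everywhere_nonmeagre_in_openin:
  assumes "second_countable T" "S \<subseteq> topspace T" "\<not> meagre_in T S"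
  obtains U where "openin T U" "U \<noteq> {}" "U \<subseteq> nonmeagre_points T S"
proof
  let ?N = "nonmeagre_points T S"
  show "openin T (T interior_of ?N)" "T interior_of ?N \<subseteq> ?N"
    by (auto simp: interior_of_subset)
  show "T interior_of ?N \<noteq> {}"
  proof
    assume "T interior_of ?N = {}"
    then have "meagre_in T ((S - ?N) \<union> (?N - T interior_of ?N))"
      by (intro meagre_in_Un meagre_in_Diff_nonmeagre_points assms
          meagre_in_Diff_interior_of closedin_nonmeagre_points)
    moreover have "S \<subseteq> (S - ?N) \<union> (?N - T interior_of ?N)" if "T interior_of ?N = {}"
      using that by blast
    ultimately show False
      using assms(3) meagre_in_subset \<open>T interior_of ?N = {}\<close> by metis
  qed
qed

lemma separable_metrizable_imp_second_countable:
  assumes "metrizable_space T" "separable_space T"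
  shows "second_countable T"
proof -
  obtain M d where "Metric_space M d" and T: "T = Metric_space.mtopology M d"
    using assms(1) unfolding metrizable_space_def by blast
  interpret Metric_space M d by fact
  obtain D where D: "countable D" "D \<subseteq> M" "mtopology closure_of D = M"
    using assms(2) unfolding separable_space_def T by auto
  define \<B> where "\<B> = (\<lambda>(c, k). mball c (inverse (real (Suc k)))) ` (D \<times> (UNIV :: nat set))"
  have "\<exists>V\<in>\<B>. x \<in> V \<and> V \<subseteq> U"
    if U: "openin mtopology U" and x: "x \<in> U" for U x
  proof -
    obtain r where r: "r > 0" "mball x r \<subseteq> U" and xM: "x \<in> M"
      using U x openin_mtopology by blast
    obtain k where k: "inverse (real (Suc k)) < r / 2"
      using reals_Archimedean[of "r/2"] r by auto
    have "x \<in> mtopology closure_of D" using D xM by simp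
    then obtain c where c: "c \<in> D" "c \<in> mball x (inverse (real (Suc k)))"
      unfolding metric_closure_of
      by (auto simp del: of_nat_Suc dest!: spec[of _ "inverse (real (Suc k))"])
    have "mball c (inverse (real (Suc k))) \<subseteq> mball x r"
    proof 
      fix y assume y: "y \<in> mball c (inverse (real (Suc k)))"
      then show "y \<in> mball x r"
        using c k triangle[of x c y] xM by auto
    qed
    moreover have "x \<in> mball c (inverse (real (Suc k)))"
      using c xM by (auto simp: commute)
    ultimately show ?thesis using c r unfolding \<B>_def by blast
  qed
  moreover have "countable \<B>"
    unfolding \<B>_def using D(1) by blast
  moreover have "openin mtopology V" if "V \<in> \<B>" for V
    using that unfolding \<B>_def by (auto simp del: of_nat_Suc)
  ultimately show ?thesis
    unfolding second_countable_def T by metis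
qed

text \<open>
  This replaces the theorem that analytic sets have the Baire property. Outside a meagre set, a point
  \<open>y\<close> at which \<open>P C\<close> is everywhere non-meagre has the same property for a small basic \<open>C' \<subseteq> C\<close>.
  Iterating gives shrinking sets whose intersection point \<open>l\<close> satisfies \<open>(l, y) \<in> F\<close>, since \<open>F\<close> is closed.
\<close>

lemma projection_closedin_locally_comeagre:
  assumes K: "completely_metrizable_space K" "second_countable K" and Y: "second_countable Y"
    and F: "closedin (prod_topology K Y) F" and B: "openin K B"
  defines "P \<equiv> \<lambda>C. {y. \<exists>k\<in>C. (k, y) \<in> F}"
  obtains N where "meagre_in Y N"
    "\<And>y. y \<in> P B - N \<Longrightarrow> \<exists>U. openin Y U \<and> y \<in> U \<and> meagre_in Y (U - P B)"
proof -
  obtain M d where "Metric_space M d" and complete: "Metric_space.mcomplete M d"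
    and K_eq: "K = Metric_space.mtopology M d"
    using K(1) unfolding completely_metrizable_space_def by blast
  interpret Metric_space M d by fact
  obtain \<B>0 where B0: "countable \<B>0" "\<And>V. V \<in> \<B>0 \<Longrightarrow> openin K V"
    "\<And>U x. openin K U \<Longrightarrow> x \<in> U \<Longrightarrow> \<exists>V\<in>\<B>0. x \<in> V \<and> V \<subseteq> U"
    using K(2) unfolding second_countable_def by metis
  \<comment> \<open>\<open>B\<close> is adjoined to the countable base so that the iteration can
    start at \<open>B\<close> itself.\<close>
  define \<B> where "\<B> = insert B \<B>0"
  have \<B>: "countable \<B>" "\<And>V. V \<in> \<B> \<Longrightarrow> openin K V" "B \<in> \<B>"
    using B0(1,2) B by (auto simp: \<B>_def)
  define U where "U C = nonmeagre_points Y (P C)" for C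
  \<comment> \<open>A closed ball of radius below \<open>e\<close> is interposed between consecutive
    sets, so that completeness yields a common point of a chain.\<close>
  define sub where "sub e C = {C'\<in>\<B>. \<exists>k r. k \<in> M \<and> 0 < r \<and> r < e \<and> C' \<subseteq> mcball k r \<and> mcball k r \<subseteq> C}"
    for e C
  \<comment> \<open>\<open>H e C\<close> collects the points where the iteration gets stuck:
    \<open>P C\<close> is everywhere non-meagre around them, but no smaller piece is non-meagre at
    them.\<close>
  define H where "H e C = U C - (\<Union>C'\<in>sub e C. U C')" for e C
  have P_top: "P C \<subseteq> topspace Y" for C
    using closedin_subset[OF F] by (auto simp: P_def)
  have P_sub: "P C \<subseteq> (\<Union>C'\<in>sub e C. P C')" if C: "C \<in> \<B>" and e: "e > 0" for e C
  proof
    fix y assume "y \<in> P C"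
    then obtain k where k: "k \<in> C" "(k, y) \<in> F" by (auto simp: P_def)
    obtain r where r: "r > 0" "mball k r \<subseteq> C" and kM: "k \<in> M"
      using \<B>(2)[OF C] k(1) unfolding K_eq openin_mtopology by blast
    define s where "s = min (r/2) (e/2)"
    have s: "0 < s" "s < e" "s < r" using r e by (auto simp: s_def)
    have "mcball k s \<subseteq> C" using s(3) r(2) by (auto simp: subset_iff)
    moreover obtain C' where "C' \<in> \<B>0" "k \<in> C'" "C' \<subseteq> mball k s"
      using B0(3)[of "mball k s" k] s kM by (auto simp: K_eq)
    moreover have "mball k s \<subseteq> mcball k s" by auto
    ultimately have "C' \<in> sub e C" using s kM unfolding sub_def \<B>_def by blast
    then show "y \<in> (\<Union>C'\<in>sub e C. P C')" using k(2) \<open>k \<in> C'\<close> by (auto simp: P_def)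
  qed
  have sub_countable: "countable (sub e C)" for e C
    using \<B>(1) countable_subset[of "sub e C" \<B>] by (auto simp: sub_def)
  \<comment> \<open>Otherwise \<open>H e C\<close> is non-meagre everywhere in some open
    \<open>W\<close>. Since it avoids each \<open>U C'\<close>, no \<open>U C'\<close> has interior
    in \<open>W\<close>, so every \<open>P C' \<inter> W\<close> is meagre. The countable union
    \<open>P C \<inter> W\<close> is then meagre, although \<open>W\<close> contains a point of
    \<open>U C\<close>.\<close>
  have H_meagre: "meagre_in Y (H e C)" if C: "C \<in> \<B>" and e: "e > 0" for e C
  proof (rule ccontr)
    assume "\<not> meagre_in Y (H e C)"
    moreover have "H e C \<subseteq> topspace Y" by (auto simp: H_def U_def nonmeagre_points_def)
    ultimately obtain W where W: "openin Y W" "W \<noteq> {}" "W \<subseteq> nonmeagre_points Y (H e C)"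
      using everywhere_nonmeagre_in_openin[OF Y] by metis
    have H_meets: "\<exists>h\<in>H e C. h \<in> V" if V: "openin Y V" "x \<in> V" "x \<in> W" for V x
    proof (rule ccontr)
      assume "\<not> ?thesis"
      then have "H e C \<inter> V = {}" by blast
      moreover have "\<not> meagre_in Y (H e C \<inter> V)"
        using W(3) V by (auto simp: nonmeagre_points_def)
      ultimately show False by simp
    qed
    obtain w where w: "w \<in> W" using W(2) by blast
    obtain h where h: "h \<in> H e C" "h \<in> W" using H_meets[OF W(1) w w] by blast
    have "meagre_in Y (U C' \<inter> W)" if C': "C' \<in> sub e C" for C'
    proof -
      have "Y interior_of U C' \<inter> W = {}"
      proof (rule ccontr)
        assume "Y interior_of U C' \<inter> W \<noteq> {}"
        then obtain x where "x \<in> Y interior_of U C'" "x \<in> W" by blast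
        then obtain g where "g \<in> H e C" "g \<in> Y interior_of U C'"
          using H_meets[OF openin_interior_of] by blast
        then show False
          using C' interior_of_subset[of Y "U C'"] by (auto simp: H_def)
      qed
      then have "U C' \<inter> W \<subseteq> U C' - Y interior_of U C'" by blast
      then show ?thesis
        by (rule meagre_in_subset[rotated])
          (simp add: meagre_in_Diff_interior_of U_def closedin_nonmeagre_points)
    qed
    then have "meagre_in Y (\<Union>C'\<in>sub e C. (P C' - U C') \<union> (U C' \<inter> W))"
      by (intro meagre_in_UN meagre_in_Un sub_countable)
        (simp_all add: U_def meagre_in_Diff_nonmeagre_points[OF Y P_top])
    moreover have "P C \<inter> W \<subseteq> (\<Union>C'\<in>sub e C. (P C' - U C') \<union> (U C' \<inter> W))"
      using P_sub[OF C e] by blast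
    ultimately have "meagre_in Y (P C \<inter> W)" by (rule meagre_in_subset)
    moreover have "h \<in> U C" using h by (simp add: H_def)
    ultimately show False
      using h(2) W(1) by (auto simp: U_def nonmeagre_points_def)
  qed
  define N0 where "N0 = (\<Union>C\<in>\<B>. \<Union>j::nat. H (inverse (real (Suc j))) C)"
  have N0: "meagre_in Y N0"
    unfolding N0_def by (intro meagre_in_UN \<B>(1) H_meagre) (simp_all del: of_nat_Suc)
  have U_P: "y \<in> P B" if y: "y \<in> U B" "y \<notin> N0" for y
  proof -
    have "\<exists>c. \<forall>n. (c n \<in> \<B> \<and> y \<in> U (c n) \<and> (n = 0 \<longrightarrow> c n = B)) \<and> c (Suc n) \<in> sub (inverse (real (Suc n))) (c n)"
    proof (rule dependent_nat_choice)
      show "\<exists>C. C \<in> \<B> \<and> y \<in> U C \<and> (0 = (0::nat) \<longrightarrow> C = B)"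
        using \<B>(3) y by blast
      fix C and n :: nat
      assume C: "C \<in> \<B> \<and> y \<in> U C \<and> (n = 0 \<longrightarrow> C = B)"
      then have "y \<notin> H (inverse (real (Suc n))) C"
        using y(2) by (auto simp: N0_def)
      then obtain C' where "C' \<in> sub (inverse (real (Suc n))) C" "y \<in> U C'"
        using C by (auto simp: H_def)
      then show "\<exists>C'. (C' \<in> \<B> \<and> y \<in> U C' \<and> (Suc n = 0 \<longrightarrow> C' = B)) \<and> C' \<in> sub (inverse (real (Suc n))) C"
        by (auto simp: sub_def)
    qed
    then obtain c where c: "\<And>n. y \<in> U (c n)" "c 0 = B"
      "\<And>n. c (Suc n) \<in> sub (inverse (real (Suc n))) (c n)" by blast
    have "\<forall>n. \<exists>k r. k \<in> M \<and> 0 < r \<and> r < inverse (real (Suc n)) \<and> c (Suc n) \<subseteq> mcball k r \<and> mcball k r \<subseteq> c n"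
      using c(3) unfolding sub_def by blast
    then obtain k r where kr: "\<And>n. k n \<in> M" "\<And>n. 0 < r n" "\<And>n. r n < inverse (real (Suc n))"
      "\<And>n. c (Suc n) \<subseteq> mcball (k n) (r n)" "\<And>n. mcball (k n) (r n) \<subseteq> c n"
      by metis
    have "\<Inter>(range (\<lambda>n. mcball (k n) (r n))) \<noteq> {}"
    proof (rule complete[unfolded mcomplete_nest, rule_format], intro conjI allI impI)
      show "closedin mtopology (mcball (k n) (r n))" for n by (rule closedin_mcball)
      show "mcball (k n) (r n) \<noteq> {}" for n using kr(1,2)[of n] less_imp_le[of 0 "r n"] by (metis centre_in_mcball_iff empty_iff)
      show "decseq (\<lambda>n. mcball (k n) (r n))"
        by (rule decseq_SucI) (use kr(4,5) in blast)
      fix e :: real assume "e > 0"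
      then obtain n where "inverse (real (Suc n)) < e" using reals_Archimedean by blast
      then have "r n \<le> e" using kr(3)[of n] by linarith
      then show "\<exists>n a. mcball (k n) (r n) \<subseteq> mcball a e"
        using mcball_subset_concentric by blast
    qed
    then obtain l where l: "\<And>n. l \<in> mcball (k n) (r n)" by blast
    \<comment> \<open>If not, a box \<open>V \<times> W\<close> around the point misses
      \<open>F\<close>. Far along the chain the sets lie in \<open>V\<close>, so their projections
      miss \<open>W\<close>, contradicting their non-meagreness at \<open>y\<close>.\<close>
    have "(l, y) \<in> F"
    proof (rule ccontr)
      assume "(l, y) \<notin> F"
      moreover have "l \<in> topspace K" "y \<in> topspace Y"
        using l[of 0] y(1) by (auto simp: K_eq U_def nonmeagre_points_def)
      moreover have "openin (prod_topology K Y) (topspace (prod_topology K Y) - F)"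
        using F by blast
      ultimately obtain V W where VW: "openin K V" "openin Y W" "l \<in> V" "y \<in> W"
        "V \<times> W \<subseteq> topspace (prod_topology K Y) - F"
        unfolding openin_prod_topology_alt by (metis DiffI SigmaI topspace_prod_topology)
      obtain e where e: "e > 0" "mball l e \<subseteq> V"
        using VW(1,3) unfolding K_eq openin_mtopology by blast
      obtain n where n: "inverse (real (Suc n)) < e / 2"
        using reals_Archimedean[of "e/2"] e(1) by auto
      have "c (Suc n) \<subseteq> V"
      proof
        fix x assume "x \<in> c (Suc n)"
        then have "d (k n) x \<le> r n" "x \<in> M" "d (k n) l \<le> r n" "l \<in> M"
          using kr(4)[of n] l[of n] by auto
        then have "d l x < e"
          using triangle[of l "k n" x] kr(1,3)[of n] n commute[of l "k n"] by linarith
        then show "x \<in> V" using e(2) \<open>l \<in> M\<close> \<open>x \<in> M\<close> by auto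
      qed
      then have "P (c (Suc n)) \<inter> W = {}"
        using VW(5) by (auto simp: P_def)
      moreover have "\<not> meagre_in Y (P (c (Suc n)) \<inter> W)"
        using c(1)[of "Suc n"] VW(2,4) by (auto simp: U_def nonmeagre_points_def)
      ultimately show False by simp
    qed
    moreover have "l \<in> B" using l[of 0] kr(5)[of 0] c(2) by blast
    ultimately show ?thesis by (auto simp: P_def)
  qed
  show thesis
  proof
    \<comment> \<open>A point of \<open>P B\<close> outside \<open>?N\<close> lies in the interior
      of \<open>U B\<close>, and there \<open>P B\<close> omits only points of the meagre set
      \<open>N0\<close>.\<close>
    let ?N = "(P B - U B) \<union> (U B - Y interior_of U B)"
    show "meagre_in Y ?N"
      unfolding U_def
      by (intro meagre_in_Un meagre_in_Diff_nonmeagre_points[OF Y P_top]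
          meagre_in_Diff_interior_of closedin_nonmeagre_points)
    fix y assume "y \<in> P B - ?N"
    then have "y \<in> Y interior_of U B" by blast
    moreover have "Y interior_of U B - P B \<subseteq> N0"
      using U_P interior_of_subset[of Y "U B"] by blast
    then have "meagre_in Y (Y interior_of U B - P B)"
      by (rule meagre_in_subset[OF N0])
    ultimately show "\<exists>U. openin Y U \<and> y \<in> U \<and> meagre_in Y (U - P B)"
      using openin_interior_of by blast
  qed
qed

section \<open>Sections of meagre sets in finite powers\<close>

lemma homeomorphic_map_power_top_Suc:
  "homeomorphic_map (power_top T (Suc n)) (prod_topology (power_top T n) T)
     (\<lambda>x. (restrict x {..<n}, x n))"
proof (rule homeomorphic_maps_imp_map)
  show "homeomorphic_maps (power_top T (Suc n)) (prod_topology (power_top T n) T)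
     (\<lambda>x. (restrict x {..<n}, x n)) (\<lambda>(x, y). x(n := y))"
    unfolding homeomorphic_maps_def
  proof (intro conjI ballI)
    have proj: "continuous_map (power_top T (Suc n)) T (\<lambda>x. x i)" if "i \<le> n" for i
      unfolding power_top_def using that by (intro continuous_map_product_projection) auto
    have "continuous_map (power_top T (Suc n)) (power_top T n) (\<lambda>x. restrict x {..<n})"
      unfolding power_top_def[of T n]
      by (rule continuous_map_componentwise[THEN iffD2]) (auto simp: proj)
    with proj show "continuous_map (power_top T (Suc n)) (prod_topology (power_top T n) T) (\<lambda>x. (restrict x {..<n}, x n))"
      by (simp add: continuous_map_pairedI)
    have "continuous_map (prod_topology (power_top T n) T) T (\<lambda>z. (fst z) i)" if "i < n" for i
    proof -
      have "continuous_map (power_top T n) T (\<lambda>x. x i)"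
        unfolding power_top_def using that by (intro continuous_map_product_projection) auto
      from continuous_map_compose[OF continuous_map_fst this] show ?thesis
        by (simp add: o_def)
    qed
    then have "continuous_map (prod_topology (power_top T n) T) T (\<lambda>z. ((fst z)(n := snd z)) i)" if "i < Suc n" for i
      using that by (cases "i = n") (auto simp: continuous_map_snd)
    moreover have "(\<lambda>z. (fst z)(n := snd z)) ` topspace (prod_topology (power_top T n) T) \<subseteq> extensional {..<Suc n}"
    proof (rule image_subsetI)
      fix z assume "z \<in> topspace (prod_topology (power_top T n) T)"
      then have "fst z \<in> extensional {..<n}"
        by (simp add: power_top_def mem_Times_iff PiE_iff)
      then show "(fst z)(n := snd z) \<in> extensional {..<Suc n}"
        by (simp add: extensional_def)
    qed
    ultimately show "continuous_map (prod_topology (power_top T n) T) (power_top T (Suc n)) (\<lambda>(x, y). x(n := y))"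
      unfolding power_top_def[of T "Suc n"]
      by (intro continuous_map_componentwise[THEN iffD2]) (auto simp: case_prod_unfold)
  next
    fix x assume "x \<in> topspace (power_top T (Suc n))"
    then show "(case (restrict x {..<n}, x n) of (x, y) \<Rightarrow> x(n := y)) = x"
      by (auto simp: power_top_def fun_eq_iff extensional_def PiE_iff)
  next
    fix z assume "z \<in> topspace (prod_topology (power_top T n) T)"
    then have "fst z \<in> extensional {..<n}"
      by (simp add: power_top_def mem_Times_iff PiE_iff)
    then show "(restrict (case z of (x, y) \<Rightarrow> x(n := y)) {..<n}, (case z of (x, y) \<Rightarrow> x(n := y)) n) = z"
      by (simp add: case_prod_unfold extensional_restrict)
  qed
qed

text \<open>Kuratowski-Ulam for splitting off the last coordinate. A tuple is extensional, so
  \<open>x(n := y)\<close> is the tuple with \<open>y\<close> appended.\<close>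

lemma meagre_in_power_top_Suc_sections:
  assumes "second_countable T" and S: "meagre_in (power_top T (Suc n)) S"
  shows "meagre_in (power_top T n) {x \<in> topspace (power_top T n). \<not> meagre_in T {y. x(n := y) \<in> S}}"
proof -
  let ?f = "\<lambda>x. (restrict x {..<n}, x n)"
  have "meagre_in (power_top T n) {x \<in> topspace (power_top T n). \<not> meagre_in T {y. (x, y) \<in> ?f ` S}}"
    by (intro meagre_in_prod_topology_sections assms(1)
        meagre_in_homeomorphic_image[OF homeomorphic_map_power_top_Suc S])
  moreover have *: "{y. x(n := y) \<in> S} \<subseteq> {y. (x, y) \<in> ?f ` S}" if "x \<in> topspace (power_top T n)" for x
  proof
    fix y assume "y \<in> {y. x(n := y) \<in> S}"
    then have "?f (x(n := y)) \<in> ?f ` S" by blast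
    moreover have "?f (x(n := y)) = (x, y)"
      using that by (simp add: power_top_def PiE_iff extensional_restrict)
    ultimately show "y \<in> {y. (x, y) \<in> ?f ` S}" by (simp only: mem_Collect_eq)
  qed
  then have "{x \<in> topspace (power_top T n). \<not> meagre_in T {y. x(n := y) \<in> S}} \<subseteq>
    {x \<in> topspace (power_top T n). \<not> meagre_in T {y. (x, y) \<in> ?f ` S}}"
    by (intro Collect_mono impI conjI) (erule conjunct1, erule conjE, erule contrapos_nn, rule meagre_in_subset, assumption, rule *)
  ultimately show ?thesis by (rule meagre_in_subset)
qed

text \<open>The zeroth power is a single point, which no nowhere dense set can contain. Thus a
  property of comeagrely many empty tuples holds for the empty tuple, where the tree starts.\<close>

lemma not_meagre_in_power_top_0: "\<not> meagre_in (power_top T 0) {\<lambda>i. undefined}"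
proof
  have top: "topspace (power_top T 0) = {\<lambda>i. undefined}"
    by (simp add: power_top_def)
  assume "meagre_in (power_top T 0) {\<lambda>i. undefined}"
  then obtain N where "nowhere_dense_in (power_top T 0) N" "(\<lambda>i. undefined) \<in> N"
    unfolding meagre_in_def by blast
  moreover from this have "N = topspace (power_top T 0)"
    unfolding nowhere_dense_in_def top by blast
  ultimately show False
    unfolding nowhere_dense_in_def
    using interior_of_topspace[of "power_top T 0"] closure_of_topspace[of "power_top T 0"] by auto
qed

section \<open>Uncountably many branches, and geometric estimates\<close>

lemma no_inj_branches_countable:
  assumes "countable C" "\<And>a :: nat \<Rightarrow> bool. c a \<in> C"
  obtains a b n where "c a = c b" "\<And>i. i < n \<Longrightarrow> a i = b i" "\<not> a n" "b n"
proof -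
  define \<phi> where "\<phi> a = to_nat_on C (c a)" for a
  have "\<not> inj \<phi>"
  proof
    assume inj: "inj \<phi>"
    \<comment> \<open>Cantor's diagonal branch: if the coding \<open>\<phi>\<close> were injective,
      \<open>D\<close> would differ from itself at its own code.\<close>
    define D where "D = (\<lambda>m. \<exists>a. \<phi> a = m \<and> \<not> a m)"
    show False
    proof (cases "D (\<phi> D)")
      case True
      then obtain a where a: "\<phi> a = \<phi> D" "\<not> a (\<phi> D)" unfolding D_def by meson
      have "a = D" using inj a(1) by (simp add: inj_eq)
      then show False using True a(2) by simp
    next
      case False
      then have "\<forall>a. \<phi> a = \<phi> D \<longrightarrow> a (\<phi> D)" by (subst (asm) (1) D_def) simp
      from this[rule_format, OF refl] show False using False by contradiction
    qed
  qed
  then obtain a b where ab: "a \<noteq> b" "\<phi> a = \<phi> b"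
    unfolding inj_def by blast
  have c_eq: "c a = c b"
    using inj_onD[OF inj_on_to_nat_on[OF assms(1)] _ assms(2) assms(2)] ab(2) by (simp add: \<phi>_def)
  define n where "n = (LEAST n. a n \<noteq> b n)"
  have "\<exists>n. a n \<noteq> b n" using ab(1) by blast
  then have n: "a n \<noteq> b n" unfolding n_def by (rule LeastI_ex)
  have less: "a i = b i" if "i < n" for i
    using not_less_Least that unfolding n_def by blast
  \<comment> \<open>The two branches may be exchanged, so the one called \<open>a\<close> turns left
    at the first difference.\<close>
  show thesis
  proof (cases "a n")
    case True
    show thesis by (rule that[of b a n]) (use True n c_eq less in auto)
  next
    case False
    show thesis by (rule that[of a b n]) (use False n c_eq less in auto)
  qed
qed

text \<open>Increments are bounded only from index \<open>n\<close> on because an entry of a tuple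
  is almost fixed only by the conjugators chosen after it.\<close>

lemma (in Metric_space) dist_geometric_chain:
  assumes p: "\<And>m. p m \<in> M" and r: "0 \<le> r"
    and step: "\<And>m. n \<le> m \<Longrightarrow> d (p (Suc m)) (p m) \<le> r * (1/2)^m"
    and m: "n \<le> m"
  shows "d (p m) (p n) \<le> 2 * r * (1/2)^n"
proof -
  \<comment> \<open>The subtracted tail of the geometric series makes the induction close.\<close>
  have "d (p (n + k)) (p n) \<le> 2 * r * (1/2)^n - 2 * r * (1/2)^(n + k)" for k
  proof (induction k)
    case (Suc k)
    have "d (p (n + Suc k)) (p n) \<le> d (p (Suc (n + k))) (p (n + k)) + d (p (n + k)) (p n)"
      using triangle[OF p p p] by simp
    also have "\<dots> \<le> r * (1/2)^(n + k) + (2 * r * (1/2)^n - 2 * r * (1/2)^(n + k))"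
      using Suc step[of "n + k"] by simp
    finally show ?case by simp
  qed (simp add: p)
  from this[of "m - n"] m have "d (p m) (p n) \<le> 2 * r * (1/2)^n - 2 * r * (1/2)^m"
    by simp
  moreover have "0 \<le> 2 * r * (1/2)^m" using r by simp
  ultimately show ?thesis by linarith
qed

lemma (in Metric_space) MCauchy_geometric:
  assumes p: "\<And>n. p n \<in> M" and step: "\<And>n. d (p (Suc n)) (p n) \<le> (1/2)^n"
  shows "MCauchy p"
  unfolding MCauchy_def
proof (intro conjI allI impI)
  show "range p \<subseteq> M" using p by (rule image_subsetI)
  fix e :: real assume "e > 0"
  then obtain N where N: "(1/2)^N < e/4"
    using real_arch_pow_inv[of "e/4" "1/2"] by auto
  have "d (p n) (p n') < e" if n: "N \<le> n" "N \<le> n'" for n n'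
  proof -
    have "d (p m) (p N) \<le> 2 * (1/2)^N" if "N \<le> m" for m
      using dist_geometric_chain[of p 1 N m] p step that by simp
    then have "d (p n) (p N) \<le> 2 * (1/2)^N" "d (p n') (p N) \<le> 2 * (1/2)^N" using n by simp_all
    moreover have "d (p n) (p n') \<le> d (p n) (p N) + d (p n') (p N)"
      using triangle[of "p n" "p N" "p n'"] p commute[of "p N"] by simp
    ultimately show ?thesis using N by linarith
  qed
  then show "\<exists>N. \<forall>n n'. N \<le> n \<longrightarrow> N \<le> n' \<longrightarrow> d (p n) (p n') < e" by (intro exI[of _ N]) simp
qed

subsection \<open>Locally generic tuples\<close>

locale polish_topometric_group = group G for G (structure) +
  fixes \<tau> :: "'a topology" and d :: "'a \<Rightarrow> 'a \<Rightarrow> real"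
  assumes topometric: "Polish_topometric_group G \<tau> d"
begin

lemma topspace_eq [simp]: "topspace \<tau> = carrier G"
  using topometric by (simp add: Polish_topometric_group_def Polish_group_def)

lemma completely_metrizable: "completely_metrizable_space \<tau>"
  using topometric by (simp add: Polish_topometric_group_def Polish_group_def Polish_space_def)

lemma second_countable: "second_countable \<tau>"
  using topometric
  by (simp add: Polish_topometric_group_def Polish_group_def Polish_space_def
      completely_metrizable_imp_metrizable_space separable_metrizable_imp_second_countable)

sublocale D: Metric_space "carrier G" d
  using topometric by (simp add: Polish_topometric_group_def)

lemma continuous_map_m_inv:
  "continuous_map T \<tau> f \<Longrightarrow> continuous_map T \<tau> (\<lambda>x. inv (f x))"
  using topometric continuous_map_compose[of T \<tau> f \<tau> "\<lambda>x. inv x"]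
  by (simp add: Polish_topometric_group_def Polish_group_def o_def)

lemma continuous_map_mult:
  assumes "continuous_map T \<tau> f" "continuous_map T \<tau> g"
  shows "continuous_map T \<tau> (\<lambda>x. f x \<otimes> g x)"
proof -
  have "continuous_map T (prod_topology \<tau> \<tau>) (\<lambda>x. (f x, g x))"
    using assms by (simp add: continuous_map_pairedI)
  then show ?thesis
    using topometric continuous_map_compose[of T "prod_topology \<tau> \<tau>" _ \<tau> "\<lambda>(x, y). x \<otimes> y"]
    by (fastforce simp: Polish_topometric_group_def Polish_group_def o_def)
qed

lemma dist_mult_left [simp]:
  "g \<in> carrier G \<Longrightarrow> x \<in> carrier G \<Longrightarrow> y \<in> carrier G \<Longrightarrow> d (g \<otimes> x) (g \<otimes> y) = d x y"
  using topometric by (simp add: Polish_topometric_group_def)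

lemma dist_mult_right [simp]:
  "g \<in> carrier G \<Longrightarrow> x \<in> carrier G \<Longrightarrow> y \<in> carrier G \<Longrightarrow> d (x \<otimes> g) (y \<otimes> g) = d x y"
  using topometric by (simp add: Polish_topometric_group_def)

text \<open>Lower semicontinuity in usable form. It makes approximate conjugacy a closed condition
  and lets bounds on \<open>d\<close> pass to \<open>\<tau>\<close>-limits, although
  \<open>d\<close> need not be \<open>\<tau>\<close>-continuous.\<close>

lemma closedin_dist_le:
  assumes "continuous_map T \<tau> f" "continuous_map T \<tau> g"
  shows "closedin T {x \<in> topspace T. d (f x) (g x) \<le> r}"
proof -
  have "continuous_map T (prod_topology \<tau> \<tau>) (\<lambda>x. (f x, g x))"
    using assms by (simp add: continuous_map_pairedI)
  moreover have "closedin (prod_topology \<tau> \<tau>) {(x, y). x \<in> carrier G \<and> y \<in> carrier G \<and> d x y \<le> r}"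
    using topometric by (simp add: Polish_topometric_group_def)
  ultimately have "closedin T {x \<in> topspace T. (f x, g x) \<in> {(x, y). x \<in> carrier G \<and> y \<in> carrier G \<and> d x y \<le> r}}"
    by (rule closedin_continuous_map_preimage)
  moreover have "f x \<in> carrier G" "g x \<in> carrier G" if "x \<in> topspace T" for x
    using assms that continuous_map_image_subset_topspace[of T \<tau>] by fastforce+
  then have "{x \<in> topspace T. (f x, g x) \<in> {(x, y). x \<in> carrier G \<and> y \<in> carrier G \<and> d x y \<le> r}}
    = {x \<in> topspace T. d (f x) (g x) \<le> r}" by auto
  ultimately show ?thesis by simp
qed

definition cnj :: "'a \<Rightarrow> 'a \<Rightarrow> 'a" where
  "cnj k x = k \<otimes> x \<otimes> inv k"

lemma cnj_closed [simp]: "k \<in> carrier G \<Longrightarrow> x \<in> carrier G \<Longrightarrow> cnj k x \<in> carrier G"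
  by (simp add: cnj_def)

lemma cnj_mult:
  "k \<in> carrier G \<Longrightarrow> l \<in> carrier G \<Longrightarrow> x \<in> carrier G \<Longrightarrow> cnj (k \<otimes> l) x = cnj k (cnj l x)"
  by (simp add: cnj_def inv_mult_group m_assoc)

lemma dist_cnj [simp]:
  "k \<in> carrier G \<Longrightarrow> x \<in> carrier G \<Longrightarrow> y \<in> carrier G \<Longrightarrow> d (cnj k x) (cnj k y) = d x y"
  by (simp add: cnj_def)

lemma continuous_map_cnj:
  "continuous_map T \<tau> f \<Longrightarrow> continuous_map T \<tau> g \<Longrightarrow> continuous_map T \<tau> (\<lambda>x. cnj (f x) (g x))"
  unfolding cnj_def by (intro continuous_map_mult continuous_map_m_inv)

lemma tuple_nbhd_conj_orbitD:
  assumes "x \<in> tuple_nbhd G d n (conj_orbit G n g) e"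
  shows "\<exists>k\<in>carrier G. \<forall>i<n. d (x i) (cnj k (g i)) < e"
proof -
  obtain y where y: "y \<in> conj_orbit G n g"
    and max: "(MAX i\<in>insert 0 {..<n}. if i < n then d (x i) (y i) else 0) < e"
    using assms unfolding tuple_nbhd_def by blast
  obtain k where k: "k \<in> carrier G"
    "y = (\<lambda>i. if i < n then k \<otimes> g i \<otimes> inv k else undefined)"
    using y unfolding conj_orbit_def by blast
  have "d (x i) (y i) < e" if i: "i < n" for i
  proof -
    have "(if i < n then d (x i) (y i) else 0) \<le> (MAX i\<in>insert 0 {..<n}. if i < n then d (x i) (y i) else 0)"
      by (rule Max_ge) (use i in blast)+
    then show ?thesis using max i by simp
  qed
  then show ?thesis using k by (auto simp: cnj_def)
qed

lemma topspace_power_top [simp]: "topspace (power_top \<tau> n) = {..<n} \<rightarrow>\<^sub>E carrier G"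
  by (simp add: power_top_def)

definition almost_conj :: "nat \<Rightarrow> 'a set \<Rightarrow> real \<Rightarrow> (nat \<Rightarrow> 'a) \<Rightarrow> 'a \<Rightarrow> 'a \<Rightarrow> bool" where
  "almost_conj n V e x y z \<longleftrightarrow> (\<exists>f\<in>V. d (cnj f z) y < e \<and> (\<forall>i<n. d (cnj f (x i)) (x i) < e))"

text \<open>The two exceptional sets are nested, first for \<open>y\<close> and then for
  \<open>z\<close> near \<open>y\<close>, so that \<open>y\<close> and \<open>z\<close> can be
  picked one after the other from two different non-meagre sets.\<close>

definition locally_generic_for :: "nat \<Rightarrow> 'a set \<Rightarrow> real \<Rightarrow> (nat \<Rightarrow> 'a) \<Rightarrow> bool" where
  "locally_generic_for n V e x \<longleftrightarrow>
    meagre_in \<tau> {y \<in> carrier G. \<nexists>U. openin \<tau> U \<and> y \<in> U \<and> meagre_in \<tau> {z \<in> U. \<not> almost_conj n V e x y z}}"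

lemma locally_generic_for_mono:
  assumes "locally_generic_for n V e x" "V \<subseteq> V'" "e \<le> e'"
  shows "locally_generic_for n V' e' x"
proof -
  have *: "almost_conj n V e x y z \<Longrightarrow> almost_conj n V' e' x y z" for y z
    using assms(2,3) unfolding almost_conj_def by (meson order_less_le_trans subsetD)
  have "meagre_in \<tau> {z \<in> U. \<not> almost_conj n V' e' x y z}" if "meagre_in \<tau> {z \<in> U. \<not> almost_conj n V e x y z}" for U y
    by (rule meagre_in_subset[OF that]) (use * in blast)
  then show ?thesis
    using assms(1) unfolding locally_generic_for_def by (rule_tac meagre_in_subset) blast+
qed

text \<open>For comeagrely many \<open>x\<close>, almost every extension of \<open>x\<close> is
  close to a conjugate of one tuple \<open>g\<close>. Sorting the conjugators into countably many
  small pieces makes the extensions reached from one piece a projection of a closed set, hence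
  locally comeagre at almost all of its points. Two extensions reached from the same piece are
  almost conjugate by an element of \<open>V\<close>.\<close>

lemma meagre_not_locally_generic_for:
  assumes ample: "ample_generics G \<tau> d" and V: "openin \<tau> V" "\<one> \<in> V" and e: "e > 0"
  shows "meagre_in (power_top \<tau> n) {x \<in> topspace (power_top \<tau> n). \<not> locally_generic_for n V e x}"
proof -
  obtain g where g: "g \<in> {..<Suc n} \<rightarrow>\<^sub>E carrier G"
    and "comeagre_in (power_top \<tau> (Suc n)) (tuple_nbhd G d (Suc n) (conj_orbit G (Suc n) g) (e/3))"
    using ample e unfolding ample_generics_def by (meson divide_pos_pos zero_less_numeral)
  define S where "S = topspace (power_top \<tau> (Suc n)) - tuple_nbhd G d (Suc n) (conj_orbit G (Suc n) g) (e/3)"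
  have S: "meagre_in (power_top \<tau> (Suc n)) S"
    using \<open>comeagre_in _ _\<close> unfolding comeagre_in_def S_def by blast
  have g_in: "g i \<in> carrier G" if "i \<le> n" for i
    using g that by (auto simp: PiE_iff)
  obtain \<B> where B: "countable \<B>" "\<And>V. V \<in> \<B> \<Longrightarrow> openin \<tau> V"
    "\<And>U x. openin \<tau> U \<Longrightarrow> x \<in> U \<Longrightarrow> \<exists>V\<in>\<B>. x \<in> V \<and> V \<subseteq> U"
    using second_countable unfolding second_countable_def by metis
  \<comment> \<open>Two conjugators from one such piece differ by an element of \<open>V\<close>; by
    continuity of the operations the pieces cover \<open>G\<close>.\<close>
  define \<B>' where "\<B>' = {B\<in>\<B>. \<forall>a\<in>B. \<forall>b\<in>B. a \<otimes> inv b \<in> V}"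
  have B'_cover: "\<exists>B\<in>\<B>'. k \<in> B" if k: "k \<in> carrier G" for k
  proof -
    have "continuous_map (prod_topology \<tau> \<tau>) \<tau> (\<lambda>z. fst z \<otimes> inv (snd z))"
      by (intro continuous_map_mult continuous_map_m_inv continuous_map_fst continuous_map_snd)
    from openin_continuous_map_preimage[OF this V(1)]
    have "openin (prod_topology \<tau> \<tau>) {z \<in> carrier G \<times> carrier G. fst z \<otimes> inv (snd z) \<in> V}" by simp
    moreover have "(k, k) \<in> {z \<in> carrier G \<times> carrier G. fst z \<otimes> inv (snd z) \<in> V}"
      using k V(2) by simp
    ultimately obtain O1 O2 where O: "openin \<tau> O1" "openin \<tau> O2" "k \<in> O1" "k \<in> O2"
      "O1 \<times> O2 \<subseteq> {z \<in> carrier G \<times> carrier G. fst z \<otimes> inv (snd z) \<in> V}"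
      unfolding openin_prod_topology_alt by meson
    then obtain B where "B \<in> \<B>" "k \<in> B" "B \<subseteq> O1 \<inter> O2"
      using B(3)[of "O1 \<inter> O2" k] by auto
    then have "B \<in> \<B>'" using O(5) by (fastforce simp: \<B>'_def)
    then show ?thesis using \<open>k \<in> B\<close> by blast
  qed
  have "locally_generic_for n V e x"
    if x: "x \<in> topspace (power_top \<tau> n)" and xS: "meagre_in \<tau> {y. x(n := y) \<in> S}" for x
  proof -
    have x_in: "x i \<in> carrier G" if "i < n" for i
      using x that by (auto simp: PiE_iff)
    \<comment> \<open>The strict bound from ample generics is weakened to \<open>\<le>\<close> so
      that the condition on conjugator and new entry is closed; index \<open>n\<close> stands for
      the new entry.\<close>
    define E where "E i = {z \<in> topspace (prod_topology \<tau> \<tau>).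
      d (cnj (fst z) (g i)) (if i < n then x i else snd z) \<le> e/3}" for i
    define F where "F = (\<Inter>i\<in>{..n}. E i)"
    have "closedin (prod_topology \<tau> \<tau>) (E i)" if "i \<le> n" for i
      unfolding E_def
      by (intro closedin_dist_le continuous_map_cnj continuous_map_fst)
        (use that g_in x_in in \<open>auto simp: continuous_map_snd\<close>)
    then have F: "closedin (prod_topology \<tau> \<tau>) F"
      unfolding F_def by (intro closedin_INT) auto
    define P where "P B = {y. \<exists>k\<in>B. (k, y) \<in> F}" for B
    have "\<exists>N. meagre_in \<tau> N \<and> (\<forall>y\<in>P B - N. \<exists>U. openin \<tau> U \<and> y \<in> U \<and> meagre_in \<tau> (U - P B))"
      if "B \<in> \<B>'" for B
    proof -
      have "openin \<tau> B" using B(2) that by (simp add: \<B>'_def)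
      then show ?thesis
      proof (rule projection_closedin_locally_comeagre
          [OF completely_metrizable second_countable second_countable F], fold P_def)
        fix N assume N: "meagre_in \<tau> N"
          "\<And>y. y \<in> P B - N \<Longrightarrow> \<exists>U. openin \<tau> U \<and> y \<in> U \<and> meagre_in \<tau> (U - P B)"
        show ?thesis by (rule exI[of _ N]) (rule conjI[OF N(1) ballI[OF N(2)]])
      qed
    qed
    then obtain N where N: "\<And>B. B \<in> \<B>' \<Longrightarrow> meagre_in \<tau> (N B)"
      "\<And>B y. B \<in> \<B>' \<Longrightarrow> y \<in> P B - N B \<Longrightarrow> \<exists>U. openin \<tau> U \<and> y \<in> U \<and> meagre_in \<tau> (U - P B)"
      by metis
    have "countable \<B>'" using B(1) by (simp add: \<B>'_def)
    then have "meagre_in \<tau> ({y. x(n := y) \<in> S} \<union> (\<Union>B\<in>\<B>'. N B))"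
      by (intro meagre_in_Un meagre_in_UN xS N(1))
    moreover have "\<exists>U. openin \<tau> U \<and> y \<in> U \<and> meagre_in \<tau> {z \<in> U. \<not> almost_conj n V e x y z}"
      if y: "y \<in> carrier G" "x(n := y) \<notin> S" "y \<notin> (\<Union>B\<in>\<B>'. N B)" for y
    proof -
      have "x(n := y) \<in> topspace (power_top \<tau> (Suc n))"
        using x y(1) by (auto simp: PiE_iff extensional_def)
      then have "x(n := y) \<in> tuple_nbhd G d (Suc n) (conj_orbit G (Suc n) g) (e/3)"
        using y(2) by (simp add: S_def)
      from tuple_nbhd_conj_orbitD[OF this] obtain k where k: "k \<in> carrier G"
        and k_close: "\<And>i. i < Suc n \<Longrightarrow> d ((x(n := y)) i) (cnj k (g i)) < e/3"
        by blast
      have kE: "d (cnj k (g i)) (if i < n then x i else y) \<le> e/3" if "i \<le> n" for i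
        using k_close[of i] that D.commute[of "cnj k (g i)"] by (auto split: if_splits)
      have "(k, y) \<in> E i" if "i \<le> n" for i
        using kE[OF that] k y(1) by (cases "i < n") (simp_all add: E_def)
      then have kF: "(k, y) \<in> F" by (simp add: F_def)
      obtain B where B: "B \<in> \<B>'" "k \<in> B" using B'_cover k by blast
      then have "y \<in> P B - N B" using kF y(3) by (auto simp: P_def)
      then obtain U where U: "openin \<tau> U" "y \<in> U" "meagre_in \<tau> (U - P B)"
        using N(2)[OF B(1)] by blast
      have "almost_conj n V e x y z" if z: "z \<in> P B" for z
      proof -
        obtain l where l: "l \<in> B" "(l, z) \<in> F" using z by (auto simp: P_def)
        then have lz: "l \<in> carrier G" "z \<in> carrier G"
          by (auto simp: F_def E_def)
        \<comment> \<open>\<open>f\<close> carries the conjugate of \<open>g\<close> by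
          \<open>l\<close> exactly to the one by \<open>k\<close>. As conjugation is isometric, the
          two errors of at most \<open>e/3\<close> add up to less than \<open>e\<close>.\<close>
        define f where "f = k \<otimes> inv l"
        have f: "f \<in> V" "f \<in> carrier G" using B l lz k by (auto simp: \<B>'_def f_def)
        have f_cnj: "cnj f (cnj l (g i)) = cnj k (g i)" if "i \<le> n" for i
          using g_in[OF that] k lz by (simp add: f_def cnj_mult[symmetric] m_assoc)
        have close: "d (cnj f v) w < e"
          if "d (cnj l (g i)) v \<le> e/3" "d (cnj k (g i)) w \<le> e/3" "v \<in> carrier G" "w \<in> carrier G" "i \<le> n" for v w i
        proof -
          have "d (cnj f v) w \<le> d (cnj f v) (cnj f (cnj l (g i))) + d (cnj f (cnj l (g i))) w"
            using that g_in[OF that(5)] lz f by (intro D.triangle) auto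
          also have "d (cnj f v) (cnj f (cnj l (g i))) = d (cnj l (g i)) v"
            using that g_in[OF that(5)] lz f D.commute[of v] by simp
          finally show ?thesis using that(1,2) e f_cnj[OF that(5)] by simp
        qed
        have lE: "d (cnj l (g i)) (if i < n then x i else z) \<le> e/3" if "i \<le> n" for i
        proof -
          have "(l, z) \<in> E i" using l(2) that by (simp add: F_def)
          then show ?thesis by (cases "i < n") (simp_all add: E_def)
        qed
        have "d (cnj f z) y < e"
          using close[of n z y] lE[of n] kE[of n] lz y(1) by simp
        moreover have "d (cnj f (x i)) (x i) < e" if "i < n" for i
          using close[of i "x i" "x i"] lE[of i] kE[of i] x_in that by simp
        ultimately show ?thesis
          unfolding almost_conj_def using f(1) by blast
      qed
      then have "meagre_in \<tau> {z \<in> U. \<not> almost_conj n V e x y z}"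
        by (intro meagre_in_subset[OF U(3)]) blast
      then show ?thesis using U by blast
    qed
    ultimately show ?thesis
      unfolding locally_generic_for_def by (rule_tac meagre_in_subset) blast+
  qed
  then show ?thesis
    by (intro meagre_in_subset[OF meagre_in_power_top_Suc_sections[OF second_countable S]]) blast
qed

definition locally_generic :: "nat \<Rightarrow> (nat \<Rightarrow> 'a) \<Rightarrow> bool" where
  "locally_generic n x \<longleftrightarrow> (\<forall>V e. openin \<tau> V \<and> \<one> \<in> V \<and> e > 0 \<longrightarrow> locally_generic_for n V e x)"

text \<open>By monotonicity, countably many conditions suffice: basic \<open>V\<close> around
  \<open>\<one>\<close> and tolerances \<open>1/(j+1)\<close>.\<close>

lemma meagre_not_locally_generic:
  assumes ample: "ample_generics G \<tau> d"
  shows "meagre_in (power_top \<tau> n) {x \<in> topspace (power_top \<tau> n). \<not> locally_generic n x}"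
proof -
  obtain \<B> where B: "countable \<B>" "\<And>V. V \<in> \<B> \<Longrightarrow> openin \<tau> V"
    "\<And>U x. openin \<tau> U \<Longrightarrow> x \<in> U \<Longrightarrow> \<exists>V\<in>\<B>. x \<in> V \<and> V \<subseteq> U"
    using second_countable unfolding second_countable_def by metis
  let ?bad = "\<lambda>V j. {x \<in> topspace (power_top \<tau> n). \<not> locally_generic_for n V (inverse (real (Suc j))) x}"
  have "meagre_in (power_top \<tau> n) (\<Union>V\<in>{V\<in>\<B>. \<one> \<in> V}. \<Union>j. ?bad V j)"
    by (intro meagre_in_UN meagre_not_locally_generic_for[OF ample])
      (use B in \<open>auto simp del: of_nat_Suc\<close>)
  moreover have "locally_generic n x"
    if x: "x \<in> topspace (power_top \<tau> n)" "x \<notin> (\<Union>V\<in>{V\<in>\<B>. \<one> \<in> V}. \<Union>j. ?bad V j)" for x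
    unfolding locally_generic_def
  proof (intro allI impI)
    fix V and e :: real assume V: "openin \<tau> V \<and> \<one> \<in> V \<and> e > 0"
    then obtain V' where V': "V' \<in> \<B>" "\<one> \<in> V'" "V' \<subseteq> V" using B(3) by blast
    obtain j where "inverse (real (Suc j)) < e" using V reals_Archimedean by blast
    moreover have "locally_generic_for n V' (inverse (real (Suc j))) x"
      using x V' by blast
    ultimately show "locally_generic_for n V e x"
      using locally_generic_for_mono V'(3) less_imp_le by blast
  qed
  ultimately show ?thesis by (rule_tac meagre_in_subset) blast+
qed

text \<open>
  A tuple has depth \<open>m\<close> if \<open>m\<close> successive comeagre choices of further entries end in a locally generic
  tuple. Being generic for all depths is what survives a comeagre choice of one more entry.
\<close>

primrec generic_depth :: "nat \<Rightarrow> nat \<Rightarrow> (nat \<Rightarrow> 'a) \<Rightarrow> bool" where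
  "generic_depth 0 n x \<longleftrightarrow> locally_generic n x"
| "generic_depth (Suc m) n x \<longleftrightarrow> meagre_in \<tau> {y \<in> carrier G. \<not> generic_depth m (Suc n) (x(n := y))}"

definition generic :: "nat \<Rightarrow> (nat \<Rightarrow> 'a) \<Rightarrow> bool" where
  "generic n x \<longleftrightarrow> (\<forall>m. generic_depth m n x)"

lemma meagre_not_generic_depth:
  assumes ample: "ample_generics G \<tau> d"
  shows "meagre_in (power_top \<tau> n) {x \<in> topspace (power_top \<tau> n). \<not> generic_depth m n x}"
proof (induction m arbitrary: n)
  case 0
  show ?case using meagre_not_locally_generic[OF ample] by simp
next
  case (Suc m)
  let ?S = "{x \<in> topspace (power_top \<tau> (Suc n)). \<not> generic_depth m (Suc n) x}"
  have "{y. x(n := y) \<in> ?S} = {y \<in> carrier G. \<not> generic_depth m (Suc n) (x(n := y))}"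
    if "x \<in> topspace (power_top \<tau> n)" for x
    using that by (auto simp: PiE_iff extensional_def lessThan_Suc)
  then have "{x \<in> topspace (power_top \<tau> n). \<not> generic_depth (Suc m) n x} =
    {x \<in> topspace (power_top \<tau> n). \<not> meagre_in \<tau> {y. x(n := y) \<in> ?S}}"
    by auto
  then show ?case
    using meagre_in_power_top_Suc_sections[OF second_countable Suc.IH[of "Suc n"]] by (simp only:)
qed

lemma generic_0:
  assumes "ample_generics G \<tau> d"
  shows "generic 0 (\<lambda>i. undefined)"
  unfolding generic_def
proof
  fix m
  show "generic_depth m 0 (\<lambda>i. undefined)"
  proof (rule ccontr)
    assume "\<not> ?thesis"
    then have "{\<lambda>i. undefined} \<subseteq> {x \<in> topspace (power_top \<tau> 0). \<not> generic_depth m 0 x}"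
      by simp
    then show False
      using meagre_not_generic_depth[OF assms, of 0 m] not_meagre_in_power_top_0 meagre_in_subset by blast
  qed
qed

lemma generic_Suc:
  assumes "generic n x"
  shows "meagre_in \<tau> {y \<in> carrier G. \<not> generic (Suc n) (x(n := y))}"
proof -
  have "meagre_in \<tau> {y \<in> carrier G. \<not> generic_depth m (Suc n) (x(n := y))}" for m
    using assms unfolding generic_def by (auto dest: spec[of _ "Suc m"])
  then have "meagre_in \<tau> (\<Union>m. {y \<in> carrier G. \<not> generic_depth m (Suc n) (x(n := y))})"
    by (intro meagre_in_UN) auto
  moreover have "{y \<in> carrier G. \<not> generic (Suc n) (x(n := y))} =
    (\<Union>m. {y \<in> carrier G. \<not> generic_depth m (Suc n) (x(n := y))})"
    by (auto simp: generic_def)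
  ultimately show ?thesis by simp
qed

text \<open>\<open>S\<close> is non-meagre in \<open>U\<close>, so it offers a \<open>y\<close>
  outside both exceptional sets. Almost every \<open>z\<close> in some neighbourhood
  \<open>W\<close> of \<open>y\<close> then works, and \<open>S'\<close> is non-meagre in
  \<open>W \<inter> U\<close>.\<close>

lemma generic_extension:
  assumes x: "generic n x" and V: "openin \<tau> V" "\<one> \<in> V" and e: "e > 0"
    and U: "openin \<tau> U" "U \<noteq> {}" "U \<subseteq> nonmeagre_points \<tau> S" "U \<subseteq> nonmeagre_points \<tau> S'"
  shows "\<exists>y z f. y \<in> S \<inter> U \<and> z \<in> S' \<inter> U \<and> f \<in> V \<and>
    generic (Suc n) (x(n := y)) \<and> generic (Suc n) (x(n := z)) \<and>
    d (cnj f z) y < e \<and> (\<forall>i<n. d (cnj f (x i)) (x i) < e)"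
proof -
  have U_in: "U \<subseteq> carrier G" using openin_subset[OF U(1)] by simp
  let ?bad = "{y \<in> carrier G. \<not> generic (Suc n) (x(n := y))}"
  let ?bad' = "{y \<in> carrier G. \<nexists>U. openin \<tau> U \<and> y \<in> U \<and> meagre_in \<tau> {z \<in> U. \<not> almost_conj n V e x y z}}"
  have "generic_depth 0 n x" using x by (simp only: generic_def)
  then have "locally_generic_for n V e x"
    using V e by (simp add: locally_generic_def)
  then have bad': "meagre_in \<tau> (?bad \<union> ?bad')"
    using generic_Suc[OF x] by (intro meagre_in_Un) (simp_all add: locally_generic_for_def)
  have "\<not> meagre_in \<tau> (S \<inter> U)"
    using U by (auto simp: nonmeagre_points_def)
  then have "\<not> S \<inter> U \<subseteq> ?bad \<union> ?bad'" using bad' meagre_in_subset by blast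
  then obtain y where y: "y \<in> S \<inter> U" "y \<notin> ?bad" "y \<notin> ?bad'" by blast
  then obtain W where W: "openin \<tau> W" "y \<in> W" "meagre_in \<tau> {z \<in> W. \<not> almost_conj n V e x y z}"
    using U_in by blast
  have "openin \<tau> (W \<inter> U)" using U(1) W(1) by blast
  then have "\<not> meagre_in \<tau> (S' \<inter> (W \<inter> U))"
    using U(4) y W by (auto simp: nonmeagre_points_def)
  then have "\<not> S' \<inter> (W \<inter> U) \<subseteq> ?bad \<union> {z \<in> W. \<not> almost_conj n V e x y z}"
    using meagre_in_subset[OF meagre_in_Un[OF generic_Suc[OF x] W(3)]] by blast
  then obtain z where z: "z \<in> S' \<inter> (W \<inter> U)" "z \<notin> ?bad" "almost_conj n V e x y z" by blast
  then obtain f where "f \<in> V" "d (cnj f z) y < e" "\<forall>i<n. d (cnj f (x i)) (x i) < e"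
    unfolding almost_conj_def by blast
  then show ?thesis using y z U_in by blast
qed

subsection \<open>The binary tree of conjugators\<close>

text \<open>The sets \<open>S\<close> and \<open>S'\<close> will be a translate of \<open>A\<close>
  and \<open>A\<close> itself. A complete metric \<open>\<rho>\<close> for \<open>\<tau>\<close>
  controls the convergence of the conjugators, while \<open>d\<close> measures the errors of
  conjugation.\<close>

lemma conjugates_meet:
  assumes ample: "ample_generics G \<tau> d" and A: "sigma_syndetic G A" and e: "e > 0"
    and U: "openin \<tau> U" "U \<noteq> {}" "U \<subseteq> nonmeagre_points \<tau> S" "U \<subseteq> nonmeagre_points \<tau> S'"
  shows "\<exists>w\<in>A. \<exists>w'\<in>A. \<exists>y\<in>S \<inter> U. \<exists>z\<in>S' \<inter> U. d (cnj w y) (cnj w' z) < e"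
proof -
  obtain M \<rho> where *: "Metric_space M \<rho>" "Metric_space.mcomplete M \<rho>" "\<tau> = Metric_space.mtopology M \<rho>"
    using completely_metrizable unfolding completely_metrizable_space_def by blast
  have "M = carrier G"
    using topspace_eq Metric_space.topspace_mtopology[OF *(1)] *(3) by simp
  with * interpret R: Metric_space "carrier G" \<rho> by simp
  have complete: "R.mcomplete" and \<tau>_eq: "\<tau> = R.mtopology"
    using * \<open>M = carrier G\<close> by simp_all
  have U_in: "U \<subseteq> carrier G" using openin_subset[OF U(1)] by simp
  obtain C where C: "countable C" "C \<subseteq> carrier G" "carrier G \<subseteq> (\<Union>c\<in>C. c <# A)" and A_in: "A \<subseteq> carrier G"
    using A unfolding sigma_syndetic_def by blast
  define \<delta> where "\<delta> = e / 3"
  have \<delta>: "\<delta> > 0" using e by (simp add: \<delta>_def)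
  have "\<exists>y z f. y \<in> S \<inter> U \<and> z \<in> S' \<inter> U \<and> f \<in> carrier G \<and> \<rho> (p \<otimes> f) p < (1/2)^n \<and>
      generic (Suc n) (x(n := y)) \<and> generic (Suc n) (x(n := z)) \<and>
      d (cnj f z) y < \<delta> * (1/2)^n \<and> (\<forall>i<n. d (cnj f (x i)) (x i) < \<delta> * (1/2)^n)"
    if x: "generic n x" and p: "p \<in> carrier G" for n x p
  proof -
    \<comment> \<open>\<open>\<rho>\<close> need not be invariant, so the neighbourhood of
      \<open>\<one>\<close> depends on the product \<open>p\<close> built so far.\<close>
    define V where "V = {f \<in> topspace \<tau>. p \<otimes> f \<in> R.mball p ((1/2)^n)}"
    have "continuous_map \<tau> \<tau> (\<lambda>f. p \<otimes> f)"
      using p by (intro continuous_map_mult) auto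
    then have V: "openin \<tau> V"
      unfolding V_def by (rule openin_continuous_map_preimage) (simp add: \<tau>_eq)
    have "\<one> \<in> V" using p by (simp add: V_def)
    from generic_extension[OF x V this _ U, of "\<delta> * (1/2)^n"] \<delta>
    obtain y z f where *: "y \<in> S \<inter> U" "z \<in> S' \<inter> U" "f \<in> V"
      "generic (Suc n) (x(n := y))" "generic (Suc n) (x(n := z))"
      "d (cnj f z) y < \<delta> * (1/2)^n" "\<forall>i<n. d (cnj f (x i)) (x i) < \<delta> * (1/2)^n"
      by auto
    moreover have "f \<in> carrier G" "\<rho> (p \<otimes> f) p < (1/2)^n"
      using \<open>f \<in> V\<close> by (simp_all add: V_def R.commute)
    ultimately show ?thesis by blast
  qed
  \<comment> \<open>The hypotheses move under the existential quantifiers so that choice gives total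
    functions of the node alone.\<close>
  then have "\<forall>n x p. \<exists>y z f. generic n x \<and> p \<in> carrier G \<longrightarrow>
      y \<in> S \<inter> U \<and> z \<in> S' \<inter> U \<and> f \<in> carrier G \<and> \<rho> (p \<otimes> f) p < (1/2)^n \<and>
      generic (Suc n) (x(n := y)) \<and> generic (Suc n) (x(n := z)) \<and>
      d (cnj f z) y < \<delta> * (1/2)^n \<and> (\<forall>i<n. d (cnj f (x i)) (x i) < \<delta> * (1/2)^n)"
    by blast
  then obtain yy zz ff where ext: "\<forall>n x p. generic n x \<and> p \<in> carrier G \<longrightarrow>
      yy n x p \<in> S \<inter> U \<and> zz n x p \<in> S' \<inter> U \<and> ff n x p \<in> carrier G \<and> \<rho> (p \<otimes> ff n x p) p < (1/2)^n \<and>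
      generic (Suc n) (x(n := yy n x p)) \<and> generic (Suc n) (x(n := zz n x p)) \<and>
      d (cnj (ff n x p) (zz n x p)) (yy n x p) < \<delta> * (1/2)^n \<and>
      (\<forall>i<n. d (cnj (ff n x p) (x i)) (x i) < \<delta> * (1/2)^n)"
    by (simp only: choice_iff) blast
  \<comment> \<open>A state is the tuple and the product of conjugators. \<open>False\<close> means
    left: append \<open>y\<close>, keep the product. \<open>True\<close> means right: append
    \<open>z\<close>, multiply by \<open>f\<close>. Both children use the same \<open>y\<close>,
    \<open>z\<close> and \<open>f\<close>.\<close>
  define st where "st a = rec_nat (\<lambda>i. undefined, \<one>) (\<lambda>n (x, p).
      if a n then (x(n := zz n x p), p \<otimes> ff n x p) else (x(n := yy n x p), p))" for a :: "nat \<Rightarrow> bool"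
  define tup where "tup a n = fst (st a n)" for a n
  define p where "p a n = snd (st a n)" for a n
  have tup_0: "tup a 0 = (\<lambda>i. undefined)" and p_0: "p a 0 = \<one>" for a
    by (simp_all add: tup_def p_def st_def)
  have tup_Suc: "tup a (Suc n) = (tup a n)(n := if a n then zz n (tup a n) (p a n) else yy n (tup a n) (p a n))"
    and p_Suc: "p a (Suc n) = (if a n then p a n \<otimes> ff n (tup a n) (p a n) else p a n)" for a n
    by (simp_all add: tup_def p_def st_def case_prod_unfold)
  have inv: "generic n (tup a n) \<and> p a n \<in> carrier G" for a n
  proof (induction n)
    case 0
    then show ?case using generic_0[OF ample] by (simp add: tup_0 p_0)
  next
    case (Suc n)
    from ext[rule_format, OF this] this show ?case
      by (cases "a n") (simp_all add: tup_Suc p_Suc del: fun_upd_apply)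
  qed
  note ext = ext[rule_format, OF inv]
  define t where "t a n = tup a (Suc n) n" for a n
  have t_eq: "t a n = (if a n then zz n (tup a n) (p a n) else yy n (tup a n) (p a n))" for a n
    by (simp add: t_def tup_Suc)
  have t_in: "t a n \<in> carrier G" for a n
    using ext[of n a] U_in by (auto simp: t_eq)
  have tup_t: "tup a m n = t a n" if "n < m" for a n m
    using that
  proof (induction m)
    case (Suc m)
    then show ?case by (cases "n = m") (simp_all add: t_def tup_Suc)
  qed simp
  have p_in: "p a n \<in> carrier G" for a n using inv by blast
  have "\<exists>h. limitin \<tau> (p a) h sequentially" for a
  proof -
    have "R.MCauchy (p a)"
    proof (rule R.MCauchy_geometric)
      show "p a n \<in> carrier G" for n by (rule p_in)
      show "\<rho> (p a (Suc n)) (p a n) \<le> (1/2)^n" for n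
        using ext[of n a] p_in by (simp add: p_Suc)
    qed
    then show ?thesis using complete unfolding R.mcomplete_def \<tau>_eq by blast
  qed
  then obtain h where h: "\<And>a. limitin \<tau> (p a) (h a) sequentially" by metis
  have h_in: "h a \<in> carrier G" for a using limitin_topspace[OF h] by simp
  \<comment> \<open>Conjugators chosen at levels after \<open>n\<close> almost fix the entry
    \<open>t a n\<close>, with summable errors, so the conjugates by the partial products stay
    within \<open>\<delta>\<close> of the one at \<open>Suc n\<close>. The bound passes to the limit
    because the set \<open>?E\<close> is closed.\<close>
  have h_close: "d (cnj (h a) (t a n)) (cnj (p a (Suc n)) (t a n)) \<le> \<delta>" for a n
  proof -
    let ?v = "\<lambda>m. cnj (p a m) (t a n)"
    have step: "d (?v (Suc m)) (?v m) \<le> \<delta> * (1/2)^m" if m: "Suc n \<le> m" for m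
    proof -
      have "d (cnj (ff m (tup a m) (p a m)) (t a n)) (t a n) < \<delta> * (1/2)^m"
      proof -
        have "n < m" using m by simp
        then have "d (cnj (ff m (tup a m) (p a m)) (tup a m n)) (tup a m n) < \<delta> * (1/2)^m"
          using ext[of m a] by blast
        then show ?thesis using tup_t[OF \<open>n < m\<close>] by simp
      qed
      then show ?thesis
        using ext[of m a] t_in p_in \<delta> by (simp add: p_Suc cnj_mult)
    qed
    have close: "d (?v m) (?v (Suc n)) \<le> \<delta>" if "Suc n \<le> m" for m
    proof -
      have "d (?v m) (?v (Suc n)) \<le> 2 * \<delta> * (1/2)^(Suc n)"
        by (rule D.dist_geometric_chain) (use t_in p_in step \<delta> that in auto)
      \<comment> \<open>Starting at \<open>Suc n\<close> supplies the factor 1/2 that cancels the 2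
        of the geometric sum.\<close>
      also have "\<dots> \<le> \<delta>" using \<delta> power_le_one[of "1/2::real" n] by simp
      finally show ?thesis .
    qed
    let ?E = "{k \<in> topspace \<tau>. d (cnj k (t a n)) (?v (Suc n)) \<le> \<delta>}"
    have "closedin \<tau> ?E"
      using t_in p_in by (intro closedin_dist_le continuous_map_cnj) auto
    moreover have "eventually (\<lambda>m. p a m \<in> ?E) sequentially"
      unfolding eventually_sequentially
    proof (intro exI[of _ "Suc n"] allI impI)
      fix m assume "Suc n \<le> m"
      then show "p a m \<in> ?E" using close p_in by simp
    qed
    ultimately have "h a \<in> ?E"
      by (intro limitin_closedin[OF h]) auto
    then show ?thesis by simp
  qed
  have "\<forall>a. \<exists>c. c \<in> C \<and> h a \<in> c <# A" using h_in C(3) by blast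
  then obtain c where c: "\<And>a. c a \<in> C" "\<And>a. h a \<in> c a <# A" by metis
  obtain a b n where ab: "c a = c b" "\<And>i. i < n \<Longrightarrow> a i = b i" "\<not> a n" "b n"
    using no_inj_branches_countable[of C c] C(1) c(1) by blast
  have "tup a m = tup b m \<and> p a m = p b m" if "m \<le> n" for m
    using that
  proof (induction m)
    case (Suc m)
    then have "tup a m = tup b m" "p a m = p b m" "a m = b m" using ab(2)[of m] by simp_all
    then show ?case by (simp only: tup_Suc p_Suc)
  \<comment> \<open>Since the branches agree below \<open>n\<close>, both pass through the same node
    at level \<open>n\<close>, so \<open>y\<close>, \<open>z\<close> and \<open>f\<close> come from
    one choice.\<close>
  qed (simp add: tup_0 p_0)
  then have tup_eq: "tup b n = tup a n" and p_eq: "p b n = p a n" by simp_all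
  define q where "q = p a n"
  define f where "f = ff n (tup a n) q"
  define y where "y = t a n"
  define z where "z = t b n"
  have yz: "y = yy n (tup a n) q" "z = zz n (tup a n) q" "p a (Suc n) = q" "p b (Suc n) = q \<otimes> f"
    using ab(3,4) by (simp_all add: y_def z_def t_eq tup_eq p_eq q_def f_def p_Suc)
  have yzf: "y \<in> S \<inter> U" "z \<in> S' \<inter> U" "f \<in> carrier G" "d (cnj f z) y < \<delta> * (1/2)^n"
    using ext[of n a] by (simp_all add: yz(1,2) f_def q_def)
  have in_G: "y \<in> carrier G" "z \<in> carrier G" "q \<in> carrier G"
    using yzf U_in p_in by (auto simp: q_def)
  have "d (cnj (h a) y) (cnj q y) \<le> \<delta>"
    using h_close[of a n] yz(3) by (simp add: y_def)
  moreover have "d (cnj (h b) z) (cnj q (cnj f z)) \<le> \<delta>"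
    using h_close[of b n] yz(4) in_G yzf(3) by (simp add: z_def[symmetric] cnj_mult)
  moreover have "d (cnj q (cnj f z)) (cnj q y) < \<delta>"
  proof -
    have "\<delta> * (1/2)^n \<le> \<delta>" using \<delta> power_le_one[of "1/2::real" n] by simp
    then show ?thesis using yzf in_G by simp
  qed
  moreover have "d (cnj (h a) y) (cnj (h b) z) \<le> d (cnj (h a) y) (cnj q y) + d (cnj q y) (cnj (h b) z)"
    using h_in in_G by (intro D.triangle) auto
  moreover have "d (cnj q y) (cnj (h b) z) \<le> d (cnj q y) (cnj q (cnj f z)) + d (cnj q (cnj f z)) (cnj (h b) z)"
    using h_in in_G yzf(3) by (intro D.triangle) auto
  \<comment> \<open>Three errors of size \<open>\<delta>\<close>: from \<open>h a\<close> back to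
    \<open>q\<close>, across the split via \<open>f\<close>, and from \<open>q \<otimes> f\<close>
    on to \<open>h b\<close>.\<close>
  ultimately have "d (cnj (h a) y) (cnj (h b) z) < e"
    using D.commute[of "cnj q y" "cnj q (cnj f z)"] D.commute[of "cnj (h b) z" "cnj q (cnj f z)"]
    by (simp add: \<delta>_def)
  moreover obtain w w' where w: "w \<in> A" "h a = c a \<otimes> w" "w' \<in> A" "h b = c a \<otimes> w'"
    using c(2)[of a] c(2)[of b] ab(1) unfolding l_coset_def by auto
  moreover have "c a \<in> carrier G" using c(1) C(2) by blast
  \<comment> \<open>The common factor \<open>c a\<close> acts as an isometry by conjugation and
    cancels, leaving \<open>w\<close> and \<open>w'\<close> from \<open>A\<close>.\<close>
  ultimately have "d (cnj w y) (cnj w' z) < e"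
    using A_in in_G by (simp add: cnj_mult subset_iff)
  then show ?thesis using w(1,3) yzf(1,2) by blast
qed

section \<open>Products and translates, and the Steinhaus property\<close>

lemma set_pow_subset:
  "A \<subseteq> carrier G \<Longrightarrow> set_pow G A n \<subseteq> carrier G"
  by (induction n) (auto simp: set_mult_def)

lemma set_pow_SucI:
  "a \<in> A \<Longrightarrow> x \<in> set_pow G A n \<Longrightarrow> a \<otimes> x \<in> set_pow G A (Suc n)"
  by (auto simp: set_mult_def)

text \<open>Prefixing a word with \<open>a \<otimes> inv a\<close> leaves its value unchanged; this
  leads from the sixth power to the tenth.\<close>

lemma set_pow_add_2:
  assumes "symmetric_set G A" "A \<noteq> {}"
  shows "set_pow G A n \<subseteq> set_pow G A (Suc (Suc n))"
proof
  fix x assume x: "x \<in> set_pow G A n"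
  obtain a where a: "a \<in> A" using assms(2) by blast
  have A: "A \<subseteq> carrier G" "inv a \<in> A" using assms(1) a by (auto simp: symmetric_set_def)
  have "a \<otimes> (inv a \<otimes> x) \<in> set_pow G A (Suc (Suc n))"
    by (intro set_pow_SucI a A x)
  moreover have "a \<otimes> (inv a \<otimes> x) = x"
    using a A x set_pow_subset[OF A(1)] by (metis inv_closed m_assoc r_inv l_one subsetD)
  ultimately show "x \<in> set_pow G A (Suc (Suc n))" by simp
qed

lemma homeomorphic_map_mult_left:
  assumes g: "g \<in> carrier G"
  shows "homeomorphic_map \<tau> \<tau> (\<lambda>x. g \<otimes> x)"
proof (rule homeomorphic_maps_imp_map)
  have "continuous_map \<tau> \<tau> (\<lambda>x. k \<otimes> x)" if "k \<in> carrier G" for k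
    using that by (intro continuous_map_mult) auto
  then show "homeomorphic_maps \<tau> \<tau> (\<lambda>x. g \<otimes> x) (\<lambda>x. inv g \<otimes> x)"
    using g by (simp add: homeomorphic_maps_def m_assoc[symmetric])
qed

text \<open>Otherwise countably many meagre translates would cover \<open>G\<close>, against
  Baire.\<close>

lemma sigma_syndetic_not_meagre:
  assumes "sigma_syndetic G A"
  shows "\<not> meagre_in \<tau> A"
proof
  assume A: "meagre_in \<tau> A"
  obtain C where C: "countable C" "C \<subseteq> carrier G" "carrier G \<subseteq> (\<Union>c\<in>C. c <# A)"
    using assms unfolding sigma_syndetic_def by blast
  have "meagre_in \<tau> (c <# A)" if "c \<in> C" for c
  proof -
    have "c <# A = (\<lambda>x. c \<otimes> x) ` A" by (auto simp: l_coset_def)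
    then show ?thesis
      using meagre_in_homeomorphic_image[OF homeomorphic_map_mult_left A] that C(2) by auto
  qed
  then have "meagre_in \<tau> (carrier G)"
    using meagre_in_subset[OF meagre_in_UN[OF C(1)] C(3)] by blast
  then have "carrier G = {}"
    using meagre_in_openin_empty[OF completely_metrizable] openin_topspace[of \<tau>] by simp
  then show False by blast
qed

lemma nonmeagre_points_mult_left:
  assumes g: "g \<in> carrier G" and x: "x \<in> nonmeagre_points \<tau> A"
  shows "g \<otimes> x \<in> nonmeagre_points \<tau> ((\<lambda>x. g \<otimes> x) ` A)"
  unfolding nonmeagre_points_def
proof (intro CollectI conjI allI impI notI)
  have x': "x \<in> carrier G" using x by (simp add: nonmeagre_points_def)
  then show "g \<otimes> x \<in> topspace \<tau>" using g by simp
  fix U assume U: "openin \<tau> U \<and> g \<otimes> x \<in> U" and m: "meagre_in \<tau> ((\<lambda>x. g \<otimes> x) ` A \<inter> U)"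
  have "continuous_map \<tau> \<tau> (\<lambda>x. g \<otimes> x)"
    using homeomorphic_imp_continuous_map[OF homeomorphic_map_mult_left[OF g]] .
  from openin_continuous_map_preimage[OF this, of U]
  have W: "openin \<tau> {x \<in> carrier G. g \<otimes> x \<in> U}" using U by simp
  have "meagre_in \<tau> ((\<lambda>x. inv g \<otimes> x) ` ((\<lambda>x. g \<otimes> x) ` A \<inter> U))"
    by (rule meagre_in_homeomorphic_image[OF homeomorphic_map_mult_left m]) (simp add: g)
  moreover have "A \<inter> {x \<in> carrier G. g \<otimes> x \<in> U} \<subseteq> (\<lambda>x. inv g \<otimes> x) ` ((\<lambda>x. g \<otimes> x) ` A \<inter> U)"
  proof
    fix v assume v: "v \<in> A \<inter> {x \<in> carrier G. g \<otimes> x \<in> U}"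
    then have "v = inv g \<otimes> (g \<otimes> v)" using g by (simp add: m_assoc[symmetric])
    then show "v \<in> (\<lambda>x. inv g \<otimes> x) ` ((\<lambda>x. g \<otimes> x) ` A \<inter> U)" using v by blast
  qed
  ultimately have "meagre_in \<tau> (A \<inter> {x \<in> carrier G. g \<otimes> x \<in> U})" by (rule meagre_in_subset)
  then show False using x W U x' by (auto simp: nonmeagre_points_def)
qed

lemma steinhaus:
  assumes ample: "ample_generics G \<tau> d" and sym: "symmetric_set G A" and syn: "sigma_syndetic G A" and e: "e > 0"
  shows "\<one> \<in> \<tau> interior_of (set_nbhd G d (set_pow G A 10) e)"
proof -
  have A_in: "A \<subseteq> carrier G" and A_inv: "\<And>a. a \<in> A \<Longrightarrow> inv a \<in> A"
    using sym by (auto simp: symmetric_set_def)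
  have A_ne: "A \<noteq> {}" using sigma_syndetic_not_meagre[OF syn] by auto
  obtain U where U: "openin \<tau> U" "U \<noteq> {}" "U \<subseteq> nonmeagre_points \<tau> A"
    using everywhere_nonmeagre_in_openin[OF second_countable _ sigma_syndetic_not_meagre[OF syn]] A_in by auto
  obtain u where u: "u \<in> U" using U(2) by blast
  have u_in: "u \<in> carrier G" using u openin_subset[OF U(1)] by auto
  \<comment> \<open>For \<open>g\<close> in this neighbourhood of \<open>\<one>\<close>, the point
    \<open>g \<otimes> u\<close> lies in both \<open>U\<close> and its translate by
    \<open>g\<close>.\<close>
  define N where "N = {g \<in> topspace \<tau>. g \<otimes> u \<in> U}"
  have "continuous_map \<tau> \<tau> (\<lambda>g. g \<otimes> u)"
    using u_in by (intro continuous_map_mult) auto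
  then have N: "openin \<tau> N"
    unfolding N_def using U(1) by (rule openin_continuous_map_preimage)
  have "N \<subseteq> set_nbhd G d (set_pow G A 10) e"
  proof
    fix g assume "g \<in> N"
    then have g: "g \<in> carrier G" "g \<otimes> u \<in> U" by (auto simp: N_def)
    let ?gA = "(\<lambda>x. g \<otimes> x) ` A"
    \<comment> \<open>This is the intersection of \<open>U\<close> with its translate by
      \<open>g\<close>, where \<open>A\<close> and its translate are both everywhere
      non-meagre.\<close>
    define W where "W = U \<inter> {x \<in> topspace \<tau>. inv g \<otimes> x \<in> U}"
    have "openin \<tau> W"
      unfolding W_def
      using openin_continuous_map_preimage[OF homeomorphic_imp_continuous_map[OF homeomorphic_map_mult_left] U(1)] U(1) g
      by blast
    moreover have "g \<otimes> u \<in> W" using u u_in g by (simp add: W_def m_assoc[symmetric])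
    moreover have "W \<subseteq> nonmeagre_points \<tau> A" using U(3) by (auto simp: W_def)
    moreover have "W \<subseteq> nonmeagre_points \<tau> ?gA"
    proof
      fix x assume "x \<in> W"
      then have "inv g \<otimes> x \<in> nonmeagre_points \<tau> A" "x \<in> carrier G" using U(3) by (auto simp: W_def)
      then show "x \<in> nonmeagre_points \<tau> ?gA"
        using nonmeagre_points_mult_left[OF g(1), of "inv g \<otimes> x" A] g(1) by (simp add: m_assoc[symmetric])
    qed
    ultimately obtain w w' y z where wz: "w \<in> A" "w' \<in> A" "y \<in> ?gA" "z \<in> A" "d (cnj w y) (cnj w' z) < e"
      using conjugates_meet[OF ample syn e, of W ?gA A] by blast
    then obtain a where a: "a \<in> A" "y = g \<otimes> a" by blast
    have in_G: "w \<in> carrier G" "w' \<in> carrier G" "z \<in> carrier G" "a \<in> carrier G"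
      using wz a A_in by auto
    \<comment> \<open>\<open>b\<close> solves \<open>cnj w (b \<otimes> a) = cnj w' z\<close>.
      Bi-invariance turns the distance from \<open>g\<close> to \<open>b\<close> into the one
      between the two conjugates. The final \<open>\<one>\<close> fits the base case of
      \<open>set_pow\<close>, so \<open>b\<close> is visibly a product of six elements of
      \<open>A\<close>.\<close>
    define b where "b = inv w \<otimes> (w' \<otimes> (z \<otimes> (inv w' \<otimes> (w \<otimes> (inv a \<otimes> \<one>)))))"
    have b_in: "b \<in> carrier G" using in_G by (simp add: b_def)
    have "d g b = d (w \<otimes> (g \<otimes> (a \<otimes> inv w))) (w \<otimes> (b \<otimes> (a \<otimes> inv w)))"
      using g(1) b_in in_G by simp
    also have "w \<otimes> (g \<otimes> (a \<otimes> inv w)) = cnj w y"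
      using g(1) in_G by (simp add: cnj_def a(2) m_assoc)
    also have "w \<otimes> (b \<otimes> (a \<otimes> inv w)) = cnj w' z"
    proof -
      have "b \<otimes> (a \<otimes> inv w) = inv w \<otimes> cnj w' z"
      proof -
        have "inv a \<otimes> (a \<otimes> inv w) = inv w"
          using in_G by (simp add: m_assoc[symmetric])
        then show ?thesis
          using in_G by (simp add: b_def cnj_def m_assoc)
      qed
      then show ?thesis using in_G by (simp add: m_assoc[symmetric])
    qed
    finally have "d g b < e" using wz(5) by simp
    moreover have "b \<in> set_pow G A 10"
    proof -
      have "b \<in> set_pow G A (Suc (Suc (Suc (Suc (Suc (Suc 0))))))"
        unfolding b_def by (intro set_pow_SucI wz a A_inv) simp
      then have "b \<in> set_pow G A (Suc (Suc (Suc (Suc (Suc (Suc (Suc (Suc (Suc (Suc 0))))))))))"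
        using set_pow_add_2[OF sym A_ne] by blast
      moreover have "Suc (Suc (Suc (Suc (Suc (Suc (Suc (Suc (Suc (Suc 0))))))))) = 10" by simp
      ultimately show ?thesis by metis
    qed
    ultimately show "g \<in> set_nbhd G d (set_pow G A 10) e"
      using g(1) by (auto simp: set_nbhd_def)
  qed
  moreover have "\<one> \<in> N" using u u_in by (simp add: N_def)
  ultimately show ?thesis using interior_of_maximal[OF _ N] by blast
qed

end

theorem theorem4p5:
  fixes G :: "('a, 'b) monoid_scheme" and \<tau> :: "'a topology" and d :: "'a \<Rightarrow> 'a \<Rightarrow> real"
  assumes "Polish_topometric_group G \<tau> d"
    and "ample_generics G \<tau> d"
  shows "\<forall>A. symmetric_set G A \<and> sigma_syndetic G A \<longrightarrow>
           (\<forall>\<epsilon>>0. \<one>\<^bsub>G\<^esub> \<in> \<tau> interior_of (set_nbhd G d (set_pow G A 10) \<epsilon>))"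
proof -
  have "group G" using assms(1) by (simp add: Polish_topometric_group_def Polish_group_def)
  then interpret polish_topometric_group G \<tau> d
    using assms(1) by (simp add: polish_topometric_group_def polish_topometric_group_axioms_def)
  show ?thesis using steinhaus[OF assms(2)] by blast
qed

end
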